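(* Let $S$ be a symmetric set without identity with a weight function $\mathrm{wt}$, and let $w_1=l_1\cdots l_n$ and $w_2=l'_1\cdots l'_m$ be two words over $S$ with $n,m\ge 1$. Then the weighted cancellation distance $d(w_1,w_2)$ can be computed within time $O(N^5)$ and space $O(N^2)$, where $N=\max\{n,m\}$.
   Context: A symmetric set without identity is a set $S$ with a fixed-point-free bijection $\mathrm{inv}:S\to S$ such that $\mathrm{inv}(\mathrm{inv}(x))=x$ for all $x\in S$. A weight function on $S$ is a function $\mathrm{wt}:S\to[0,\infty)$ with $\mathrm{wt}(\mathrm{inv}(x))=\mathrm{wt}(x)$ for all $x$. Two disjoint pairs $\{i,j\}$, $\{k,r\}$ of integers with $i<j$, $k<r$ are linked if $i<k<j<r$ or $k<i<r<j$. A folding of a word $w=l_1\cdots l_n$ over $S$ is a collection $\mathcal F$ of pairwise disjoint two-element subsets of $\{1,\dots,n\}$ such that $l_i=\mathrm{inv}(l_j)$ for every $\{i,j\}\in\mathcal F$, and no two pairs of $\mathcal F$ are linked. A position is unpaired in $\mathcal F$ if it belongs to no pair of $\mathcal F$. A mixed folding of $w_1=l_1\cdots l_n$ and $w_2=l'_1\cdots l'_m$ is a triple $(\mathcal F,p,q)$ with integers $0\le p\le n-1$, $0\le q\le m-1$, where $\mathcal F$ is a folding of the word $$w_{p,q}=l_{p+1}\cdots l_n\, l_1\cdots l_p\,\mathrm{inv}(l'_q)\cdots\mathrm{inv}(l'_1)\,\mathrm{inv}(l'_m)\cdots\mathrm{inv}(l'_{q+1}).$$ The weighted cancellation distance $d(w_1,w_2)$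 is the minimum, over all mixed foldings $(\mathcal F,p,q)$, of the sum of the weights of the letters of $w_{p,q}$ at the unpaired positions of $\mathcal F$. Arithmetic operations on and comparisons of weights, and comparisons of letters, are counted as unit cost. *)

theory Defs
  imports Complex_Main "HOL-Library.Landau_Symbols"
begin

section \<open>Weighted cancellation distance\<close>

definition symmetric_set :: "'a set \<Rightarrow> ('a \<Rightarrow> 'a) \<Rightarrow> bool" where
  "symmetric_set S \<iota> \<longleftrightarrow>
     bij_betw \<iota> S S \<and> (\<forall>x\<in>S. \<iota> x \<noteq> x) \<and> (\<forall>x\<in>S. \<iota> (\<iota> x) = x)"

definition weight_function :: "'a set \<Rightarrow> ('a \<Rightarrow> 'a) \<Rightarrow> ('a \<Rightarrow> real) \<Rightarrow> bool" where
  "weight_function S \<iota> wt \<longleftrightarrow> (\<forall>x\<in>S. 0 \<le> wt x) \<and> (\<forall>x\<in>S. wt (\<iota> x) = wt x)"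

text \<open>Positions in a word are numbered from 1.\<close>

definition letter :: "'a list \<Rightarrow> nat \<Rightarrow> 'a" where
  "letter w i = w ! (i - 1)"

definition linked :: "nat set \<Rightarrow> nat set \<Rightarrow> bool" where
  "linked A B \<longleftrightarrow> (\<exists>i j k r. A = {i, j} \<and> B = {k, r} \<and> i < j \<and> k < r \<and>
     (i < k \<and> k < j \<and> j < r \<or> k < i \<and> i < r \<and> r < j))"

definition folding :: "('a \<Rightarrow> 'a) \<Rightarrow> 'a list \<Rightarrow> nat set set \<Rightarrow> bool" where
  "folding \<iota> w F \<longleftrightarrow>
     (\<forall>A\<in>F. A \<subseteq> {1..length w} \<and> card A = 2) \<and>
     pairwise disjnt F \<and>
     (\<forall>i j. {i, j} \<in> F \<longrightarrow> letter w i = \<iota> (letter w j)) \<and>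
     (\<forall>A\<in>F. \<forall>B\<in>F. \<not> linked A B)"

definition mixed_word :: "('a \<Rightarrow> 'a) \<Rightarrow> 'a list \<Rightarrow> 'a list \<Rightarrow> nat \<Rightarrow> nat \<Rightarrow> 'a list" where
  "mixed_word \<iota> w1 w2 p q =
     drop p w1 @ take p w1 @ map \<iota> (rev (take q w2)) @ map \<iota> (rev (drop q w2))"

definition mixed_foldings ::
  "('a \<Rightarrow> 'a) \<Rightarrow> 'a list \<Rightarrow> 'a list \<Rightarrow> (nat set set \<times> nat \<times> nat) set" where
  "mixed_foldings \<iota> w1 w2 =
     {(F, p, q). p < length w1 \<and> q < length w2 \<and> folding \<iota> (mixed_word \<iota> w1 w2 p q) F}"

definition unpaired_weight :: "('a \<Rightarrow> real) \<Rightarrow> 'a list \<Rightarrow> nat set set \<Rightarrow> real" where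
  "unpaired_weight wt w F = (\<Sum>i\<in>{1..length w} - \<Union>F. wt (letter w i))"

definition cancellation_distance ::
  "('a \<Rightarrow> 'a) \<Rightarrow> ('a \<Rightarrow> real) \<Rightarrow> 'a list \<Rightarrow> 'a list \<Rightarrow> real" where
  "cancellation_distance \<iota> wt w1 w2 =
     Min ((\<lambda>(F, p, q). unpaired_weight wt (mixed_word \<iota> w1 w2 p q) F) ` mixed_foldings \<iota> w1 w2)"

text \<open>The minimum is taken over a finite nonempty set, so \<open>Min\<close> is meaningful.\<close>

lemma finite_mixed_foldings: "finite (mixed_foldings \<iota> w1 w2)"
proof -
  have "mixed_foldings \<iota> w1 w2
      \<subseteq> Pow (Pow {1..length w1 + length w2}) \<times> {..<length w1} \<times> {..<length w2}"
    by (fastforce simp: mixed_foldings_def folding_def mixed_word_def)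
  then show ?thesis
    by (rule finite_subset) simp
qed

lemma mixed_foldings_nonempty:
  assumes "w1 \<noteq> []" "w2 \<noteq> []"
  shows "mixed_foldings \<iota> w1 w2 \<noteq> {}"
proof -
  have "({}, 0, 0) \<in> mixed_foldings \<iota> w1 w2"
    using assms by (simp add: mixed_foldings_def folding_def)
  then show ?thesis by blast
qed


section \<open>The machine model\<close>

text \<open>
  A random access machine with structured control flow and three unbounded memories: one for
  natural numbers (indices and addresses), one for letters and one for weights. A program is
  a fixed finite text that mentions no particular letter and no weight other than 0; it
  accesses the symmetric set only through the involution, the weight function and equality of
  letters. Every constant, memory access, operation, comparison and control step costs one
  unit of time. The space used is the number of distinct memory cells, of any of the three
  memories, that are read or written during the run (the input cells included).
\<close>

record 'a memory =
  imem :: "nat \<Rightarrow> nat"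
  lmem :: "nat \<Rightarrow> 'a"
  wmem :: "nat \<Rightarrow> real"

datatype cell = ICell nat | LCell nat | WCell nat

datatype iexp = IConst nat | IGet iexp | IAdd iexp iexp | ISub iexp iexp | IMul iexp iexp

datatype lexp = LGet iexp | LInv lexp

datatype wexp = WZero | WGet iexp | WOf lexp | WAdd wexp wexp | WSub wexp wexp

datatype bexp = ILess iexp iexp | LEq lexp lexp | WLess wexp wexp | BNot bexp | BAnd bexp bexp

datatype com =
    Skip
  | ISet iexp iexp
  | LSet iexp lexp
  | WSet iexp wexp
  | Seq com com
  | Cond bexp com com
  | While bexp com

text \<open>Evaluating an expression yields its value, the time taken and the cells accessed.\<close>

type_synonym 'v result = "'v \<times> nat \<times> cell set"

fun op1 :: "('u \<Rightarrow> 'v) \<Rightarrow> 'u result \<Rightarrow> 'v result" where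
  "op1 f (x, t, X) = (f x, t + 1, X)"

fun op2 :: "('u \<Rightarrow> 'v \<Rightarrow> 'r) \<Rightarrow> 'u result \<Rightarrow> 'v result \<Rightarrow> 'r result" where
  "op2 f (x, t, X) (y, u, Y) = (f x y, t + u + 1, X \<union> Y)"

fun fetch :: "(nat \<Rightarrow> cell) \<Rightarrow> (nat \<Rightarrow> 'v) \<Rightarrow> nat result \<Rightarrow> 'v result" where
  "fetch c mem (a, t, X) = (mem a, t + 1, insert (c a) X)"

primrec ieval :: "'a memory \<Rightarrow> iexp \<Rightarrow> nat result" where
  "ieval \<sigma> (IConst k) = (k, 1, {})"
| "ieval \<sigma> (IGet a) = fetch ICell (imem \<sigma>) (ieval \<sigma> a)"
| "ieval \<sigma> (IAdd d e) = op2 (+) (ieval \<sigma> d) (ieval \<sigma> e)"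
| "ieval \<sigma> (ISub d e) = op2 (-) (ieval \<sigma> d) (ieval \<sigma> e)"
| "ieval \<sigma> (IMul d e) = op2 (*) (ieval \<sigma> d) (ieval \<sigma> e)"

primrec leval :: "('a \<Rightarrow> 'a) \<Rightarrow> 'a memory \<Rightarrow> lexp \<Rightarrow> 'a result" where
  "leval \<iota> \<sigma> (LGet a) = fetch LCell (lmem \<sigma>) (ieval \<sigma> a)"
| "leval \<iota> \<sigma> (LInv e) = op1 \<iota> (leval \<iota> \<sigma> e)"

primrec weval ::
  "('a \<Rightarrow> 'a) \<Rightarrow> ('a \<Rightarrow> real) \<Rightarrow> 'a memory \<Rightarrow> wexp \<Rightarrow> real result" where
  "weval \<iota> wt \<sigma> WZero = (0, 1, {})"
| "weval \<iota> wt \<sigma> (WGet a) = fetch WCell (wmem \<sigma>) (ieval \<sigma> a)"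
| "weval \<iota> wt \<sigma> (WOf e) = op1 wt (leval \<iota> \<sigma> e)"
| "weval \<iota> wt \<sigma> (WAdd d e) = op2 (+) (weval \<iota> wt \<sigma> d) (weval \<iota> wt \<sigma> e)"
| "weval \<iota> wt \<sigma> (WSub d e) = op2 (-) (weval \<iota> wt \<sigma> d) (weval \<iota> wt \<sigma> e)"

primrec beval ::
  "('a \<Rightarrow> 'a) \<Rightarrow> ('a \<Rightarrow> real) \<Rightarrow> 'a memory \<Rightarrow> bexp \<Rightarrow> bool result" where
  "beval \<iota> wt \<sigma> (ILess d e) = op2 (<) (ieval \<sigma> d) (ieval \<sigma> e)"
| "beval \<iota> wt \<sigma> (LEq d e) = op2 (=) (leval \<iota> \<sigma> d) (leval \<iota> \<sigma> e)"
| "beval \<iota> wt \<sigma> (WLess d e) = op2 (<) (weval \<iota> wt \<sigma> d) (weval \<iota> wt \<sigma> e)"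
| "beval \<iota> wt \<sigma> (BNot b) = op1 Not (beval \<iota> wt \<sigma> b)"
| "beval \<iota> wt \<sigma> (BAnd b c) = op2 (\<and>) (beval \<iota> wt \<sigma> b) (beval \<iota> wt \<sigma> c)"

text \<open>
  \<open>exec M \<iota> wt c \<sigma> t X \<sigma>'\<close>: started in \<open>\<sigma>\<close>, the program \<open>c\<close> halts in \<open>\<sigma>'\<close> after \<open>t\<close> steps,
  having accessed exactly the cells in \<open>X\<close>. The parameter \<open>M\<close> is the largest number that fits
  into a cell: storing a larger one leaves the machine stuck. Without such a limit, unit-cost
  arithmetic could pack arbitrarily much data into a single cell. Numbers that occur inside
  an expression but are not stored are bounded by a fixed power of \<open>M\<close> (or of the input
  lengths and the constants of the program), because expressions have fixed size.
\<close>

inductive exec ::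
  "nat \<Rightarrow> ('a \<Rightarrow> 'a) \<Rightarrow> ('a \<Rightarrow> real) \<Rightarrow> com \<Rightarrow> 'a memory \<Rightarrow> nat \<Rightarrow> cell set \<Rightarrow> 'a memory \<Rightarrow> bool"
  for M :: nat and \<iota> :: "'a \<Rightarrow> 'a" and wt :: "'a \<Rightarrow> real" where
  Skip: "exec M \<iota> wt Skip \<sigma> 1 {} \<sigma>"
| ISet: "\<lbrakk>ieval \<sigma> a = (i, t, X); ieval \<sigma> e = (v, u, Y); v \<le> M\<rbrakk> \<Longrightarrow>
    exec M \<iota> wt (ISet a e) \<sigma> (t + u + 1) (insert (ICell i) (X \<union> Y)) (\<sigma>\<lparr>imem := (imem \<sigma>)(i := v)\<rparr>)"
| LSet: "\<lbrakk>ieval \<sigma> a = (i, t, X); leval \<iota> \<sigma> e = (v, u, Y)\<rbrakk> \<Longrightarrow>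
    exec M \<iota> wt (LSet a e) \<sigma> (t + u + 1) (insert (LCell i) (X \<union> Y)) (\<sigma>\<lparr>lmem := (lmem \<sigma>)(i := v)\<rparr>)"
| WSet: "\<lbrakk>ieval \<sigma> a = (i, t, X); weval \<iota> wt \<sigma> e = (v, u, Y)\<rbrakk> \<Longrightarrow>
    exec M \<iota> wt (WSet a e) \<sigma> (t + u + 1) (insert (WCell i) (X \<union> Y)) (\<sigma>\<lparr>wmem := (wmem \<sigma>)(i := v)\<rparr>)"
| Seq: "\<lbrakk>exec M \<iota> wt c \<sigma> t X \<sigma>'; exec M \<iota> wt d \<sigma>' u Y \<sigma>''\<rbrakk> \<Longrightarrow>
    exec M \<iota> wt (Seq c d) \<sigma> (t + u) (X \<union> Y) \<sigma>''"
| CondTrue: "\<lbrakk>beval \<iota> wt \<sigma> b = (True, t, X); exec M \<iota> wt c \<sigma> u Y \<sigma>'\<rbrakk> \<Longrightarrow>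
    exec M \<iota> wt (Cond b c d) \<sigma> (t + u + 1) (X \<union> Y) \<sigma>'"
| CondFalse: "\<lbrakk>beval \<iota> wt \<sigma> b = (False, t, X); exec M \<iota> wt d \<sigma> u Y \<sigma>'\<rbrakk> \<Longrightarrow>
    exec M \<iota> wt (Cond b c d) \<sigma> (t + u + 1) (X \<union> Y) \<sigma>'"
| WhileFalse: "beval \<iota> wt \<sigma> b = (False, t, X) \<Longrightarrow>
    exec M \<iota> wt (While b c) \<sigma> (t + 1) X \<sigma>"
| WhileTrue: "\<lbrakk>beval \<iota> wt \<sigma> b = (True, t, X); exec M \<iota> wt c \<sigma> u Y \<sigma>';
      exec M \<iota> wt (While b c) \<sigma>' v Z \<sigma>''\<rbrakk> \<Longrightarrow>
    exec M \<iota> wt (While b c) \<sigma> (t + u + v + 1) (X \<union> Y \<union> Z) \<sigma>''"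

text \<open>
  The number cells 0 and 1 initially hold the lengths of the two words, and the letter cells
  from 0 on hold the letters of \<open>w1\<close> followed by those of \<open>w2\<close>. All other number and weight
  cells hold 0, all other letter cells hold unspecified letters.
\<close>

definition input_memory :: "'a list \<Rightarrow> 'a list \<Rightarrow> 'a memory \<Rightarrow> bool" where
  "input_memory w1 w2 \<sigma> \<longleftrightarrow>
     imem \<sigma> = (\<lambda>_. 0)(0 := length w1, 1 := length w2) \<and>
     (\<forall>i < length w1 + length w2. lmem \<sigma> i = (w1 @ w2) ! i) \<and>
     wmem \<sigma> = (\<lambda>_. 0)"

text \<open>The result of a run is the content of weight cell 0.\<close>

definition computes_within ::
  "nat \<Rightarrow> ('a \<Rightarrow> 'a) \<Rightarrow> ('a \<Rightarrow> real) \<Rightarrow> com \<Rightarrow> 'a list \<Rightarrow> 'a list \<Rightarrow> real \<Rightarrow> nat \<Rightarrow> nat \<Rightarrow> bool" where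
  "computes_within M \<iota> wt P w1 w2 r time space \<longleftrightarrow>
     (\<forall>\<sigma>. input_memory w1 w2 \<sigma> \<longrightarrow>
       (\<exists>t X \<sigma>'. exec M \<iota> wt P \<sigma> t X \<sigma>' \<and> wmem \<sigma>' 0 = r \<and> t \<le> time \<and> card X \<le> space))"

text \<open>
  Runs are unique, and the set of accessed cells is finite, so that \<open>card\<close> does count it.
\<close>

lemma exec_deterministic:
  assumes "exec M \<iota> wt c \<sigma> t X \<sigma>'" "exec M \<iota> wt c \<sigma> u Y \<sigma>''"
  shows "u = t \<and> Y = X \<and> \<sigma>'' = \<sigma>'"
  using assms
proof (induction arbitrary: u Y \<sigma>'' rule: exec.induct)
  case Skip
  then show ?case by cases simp_all
next
  case ISet
  from ISet.prems show ?case by cases (use ISet.hyps in simp)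
next
  case LSet
  from LSet.prems show ?case by cases (use LSet.hyps in simp)
next
  case WSet
  from WSet.prems show ?case by cases (use WSet.hyps in simp)
next
  case (Seq c \<sigma> r R \<sigma>1 d v V \<sigma>2)
  note IH = Seq.IH
  from Seq.prems show ?case
  proof cases
    case run: (Seq r' R' \<rho> v' V')
    have 1: "r' = r \<and> R' = R \<and> \<rho> = \<sigma>1"
      using IH(1) run(3) .
    with run(4) have "exec M \<iota> wt d \<sigma>1 v' V' \<sigma>''"
      by simp
    from IH(2)[OF this] 1 run(1,2) show ?thesis by simp
  qed
next
  case (CondTrue \<sigma> b r R c v V \<sigma>1 d)
  note hyp = CondTrue.hyps(1) and IH = CondTrue.IH
  from CondTrue.prems show ?case
  proof cases
    case (CondTrue r' R' v' V')
    from IH[OF CondTrue(4)] hyp CondTrue(1-3) show ?thesis by simp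
  qed (simp add: hyp)
next
  case (CondFalse \<sigma> b r R d v V \<sigma>1 c)
  note hyp = CondFalse.hyps(1) and IH = CondFalse.IH
  from CondFalse.prems show ?case
  proof cases
    case (CondFalse r' R' v' V')
    from IH[OF CondFalse(4)] hyp CondFalse(1-3) show ?thesis by simp
  qed (simp add: hyp)
next
  case WhileFalse
  from WhileFalse.prems show ?case by cases (use WhileFalse.hyps in simp_all)
next
  case (WhileTrue \<sigma> b r R c v V \<sigma>1 z Z \<sigma>2)
  note hyp = WhileTrue.hyps(1) and IH = WhileTrue.IH
  from WhileTrue.prems show ?case
  proof cases
    case (WhileTrue r' R' v' V' \<rho> z' Z')
    have 1: "v' = v \<and> V' = V \<and> \<rho> = \<sigma>1"
      using IH(1) WhileTrue(4) .
    with WhileTrue(5) have "exec M \<iota> wt (While b c) \<sigma>1 z' Z' \<sigma>''"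
      by simp
    from IH(2)[OF this] 1 hyp WhileTrue(1-3) show ?thesis by simp
  qed (simp add: hyp)
qed

lemma finite_cells_fetch: "finite (snd (snd r)) \<Longrightarrow> finite (snd (snd (fetch c mem r)))"
  by (cases r) simp

lemma finite_cells_op1: "finite (snd (snd r)) \<Longrightarrow> finite (snd (snd (op1 f r)))"
  by (cases r) simp

lemma finite_cells_op2:
  "finite (snd (snd r)) \<Longrightarrow> finite (snd (snd s)) \<Longrightarrow> finite (snd (snd (op2 f r s)))"
  by (cases r; cases s) simp

lemmas finite_cells = finite_cells_fetch finite_cells_op1 finite_cells_op2

lemma finite_cells_ieval: "finite (snd (snd (ieval \<sigma> e)))"
  by (induction e) (simp_all add: finite_cells)

lemma finite_cells_leval: "finite (snd (snd (leval \<iota> \<sigma> e)))"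
  by (induction e) (simp_all add: finite_cells finite_cells_ieval)

lemma finite_cells_weval: "finite (snd (snd (weval \<iota> wt \<sigma> e)))"
  by (induction e) (simp_all add: finite_cells finite_cells_ieval finite_cells_leval)

lemma finite_cells_beval: "finite (snd (snd (beval \<iota> wt \<sigma> b)))"
  by (induction b)
    (simp_all add: finite_cells finite_cells_ieval finite_cells_leval finite_cells_weval)

lemma exec_finite_cells: "exec M \<iota> wt c \<sigma> t X \<sigma>' \<Longrightarrow> finite X"
proof (induction rule: exec.induct)
  case (ISet \<sigma> a i t X e v u Y)
  then show ?case using finite_cells_ieval[of \<sigma> a] finite_cells_ieval[of \<sigma> e] by simp
next
  case (LSet \<sigma> a i t X e v u Y)
  then show ?case using finite_cells_ieval[of \<sigma> a] finite_cells_leval[of \<iota> \<sigma> e] by simp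
next
  case (WSet \<sigma> a i t X e v u Y)
  then show ?case using finite_cells_ieval[of \<sigma> a] finite_cells_weval[of \<iota> wt \<sigma> e] by simp
next
  case (CondTrue \<sigma> b)
  then show ?case using finite_cells_beval[of \<iota> wt \<sigma> b] by simp
next
  case (CondFalse \<sigma> b)
  then show ?case using finite_cells_beval[of \<iota> wt \<sigma> b] by simp
next
  case (WhileFalse \<sigma> b)
  then show ?case using finite_cells_beval[of \<iota> wt \<sigma> b] by simp
next
  case (WhileTrue \<sigma> b)
  then show ?case using finite_cells_beval[of \<iota> wt \<sigma> b] by simp
qed simp_all

end

theory Submission imports Defs begin

text \<open>
  For each of the \<open>nm\<close> pairs \<open>(p, q)\<close>, an optimal folding of the mixed word, which has length
  \<open>n + m\<close>, is found by dynamic programming over intervals. If the first letter of an interval is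
  paired with a later one, then, as pairs are not linked, the other pairs lie strictly between the
  two or strictly after the second, and the two parts can be optimised independently. This takes
  cubic time per pair \<open>(p, q)\<close>, and the quadratic table is reused for all of them.
\<close>

section \<open>Optimal foldings of intervals\<close>

text \<open>The optimum of an interval depends only on strictly shorter intervals, so the table is
  ordered by length and every value is ready when it is read. The mixed word is written out once for
  each \<open>(p, q)\<close>, at linear cost, so the cubic part never deals with rotations and
  reversals. Weights contain no infinity, so each minimum starts from a genuine candidate: that of
  an interval from the case of an unpaired first letter, the global one from the pair
  \<open>(0, 0)\<close>. Starting an interval in this way also overwrites what the previous
  \<open>(p, q)\<close> left there, so the table needs no clearing. Time is added up along the run,
  whereas space is an inclusion in one fixed set of cells, which repetition does not enlarge. The
  only stored numbers are loop counters, so a linear cell capacity is enough; the quadratic table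
  addresses arise only inside expressions.\<close>

definition foldings_within :: "('a \<Rightarrow> 'a) \<Rightarrow> 'a list \<Rightarrow> nat \<Rightarrow> nat \<Rightarrow> nat set set set" where
  "foldings_within \<iota> u i k = {F. folding \<iota> u F \<and> \<Union>F \<subseteq> {i+1..i+k}}"

definition unpaired_weight_within ::
  "('a \<Rightarrow> real) \<Rightarrow> 'a list \<Rightarrow> nat \<Rightarrow> nat \<Rightarrow> nat set set \<Rightarrow> real" where
  "unpaired_weight_within wt u i k F = (\<Sum>x\<in>{i+1..i+k} - \<Union>F. wt (letter u x))"

text \<open>Intervals keep the positions of the full word instead of becoming words of their own, so
  foldings of different intervals can be united without renumbering. Positions count from 1 and list
  indices from 0: the first position is \<open>i + 1\<close>, its letter is
  \<open>u ! i\<close>.\<close>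

definition opt :: "('a \<Rightarrow> 'a) \<Rightarrow> ('a \<Rightarrow> real) \<Rightarrow> 'a list \<Rightarrow> nat \<Rightarrow> nat \<Rightarrow> real" where
  "opt \<iota> wt u i k = Min (unpaired_weight_within wt u i k ` foldings_within \<iota> u i k)"

lemma finite_foldings_within: "finite (foldings_within \<iota> u i k)"
  by (rule finite_subset[of _ "Pow (Pow {i+1..i+k})"]) (auto simp: foldings_within_def)

lemma empty_in_foldings_within: "{} \<in> foldings_within \<iota> u i k"
  by (simp add: foldings_within_def folding_def)

lemma opt_le: "F \<in> foldings_within \<iota> u i k \<Longrightarrow> opt \<iota> wt u i k \<le> unpaired_weight_within wt u i k F"
  unfolding opt_def by (intro Min_le) (auto simp: finite_foldings_within)

lemma opt_attained:
  obtains F where "F \<in> foldings_within \<iota> u i k" "opt \<iota> wt u i k = unpaired_weight_within wt u i k F"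
proof -
  have "opt \<iota> wt u i k \<in> unpaired_weight_within wt u i k ` foldings_within \<iota> u i k"
    unfolding opt_def
    by (intro Min_in) (use empty_in_foldings_within[of \<iota> u i k] in \<open>auto simp: finite_foldings_within\<close>)
  then show ?thesis using that by blast
qed

lemma opt_0: "opt \<iota> wt u i 0 = 0"
  using opt_attained[of \<iota> u i 0 wt] by (auto simp: unpaired_weight_within_def)

section \<open>Assembling foldings from unlinked pieces\<close>

lemma foldingD:
  assumes "folding \<iota> u F" "A \<in> F"
  shows "A \<subseteq> {1..length u}" "card A = 2"
  using assms unfolding folding_def by blast+

lemma folding_empty: "folding \<iota> u {}"
  by (simp add: folding_def)

lemma folding_subset: "folding \<iota> u F \<Longrightarrow> G \<subseteq> F \<Longrightarrow> folding \<iota> u G"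
  unfolding folding_def pairwise_def by blast

text \<open>Linked pairs interleave, so each has an element below some element of the other; a cut
  between \<open>A\<close> and \<open>B\<close> excludes this. Both orders are stated because
  \<open>folding\<close> forbids links between ordered pairs of members.\<close>

lemma not_linked_separated:
  assumes "A \<subseteq> {..<x}" "B \<subseteq> {x..}" shows "\<not> linked A B" "\<not> linked B A"
proof -
  have "a < b" if "a \<in> A" "b \<in> B" for a b using assms that by fastforce
  then show "\<not> linked A B" "\<not> linked B A"
    unfolding linked_def by (metis insertCI less_asym)+
qed

lemma not_linked_nested:
  assumes "A \<subseteq> {i<..<j}" shows "\<not> linked A {i, j}" "\<not> linked {i, j} A"
proof -
  have False if "A = {a, b}" "{i, j} = {k, r}" "a < b" "k < r"
      "a < k \<and> k < b \<and> b < r \<or> k < a \<and> a < r \<and> r < b" for a b k r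
  proof -
    have "i < a" "b < j" using assms that(1) by auto
    moreover have "k = i \<and> r = j \<or> k = j \<and> r = i" using that(2) by (auto simp: doubleton_eq_iff)
    ultimately show False using that(3-5) by auto
  qed
  then show "\<not> linked A {i, j}" "\<not> linked {i, j} A" unfolding linked_def by metis+
qed

text \<open>A cut just after \<open>j\<close> separates \<open>G\<close> from everything else, and
  the members of \<open>F\<close> are nested in \<open>{i, j}\<close>. As \<open>{i, j}\<close> and
  \<open>{j, i}\<close> are the same set, the letter condition has to hold in both
  directions.\<close>

lemma folding_insert_pair:
  assumes F: "folding \<iota> u F" and G: "folding \<iota> u G"
    and Fs: "\<Union>F \<subseteq> {i<..<j}" and Gs: "\<Union>G \<subseteq> {j<..}" and ij: "1 \<le> i" "i < j" "j \<le> length u"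
    and l: "letter u i = \<iota> (letter u j)" "letter u j = \<iota> (letter u i)"
  shows "folding \<iota> u (insert {i, j} (F \<union> G))"
proof -
  let ?H = "insert {i, j} (F \<union> G)"
  have f: "A \<subseteq> {i<..<j}" if "A \<in> F" for A using Fs that by blast
  have g: "A \<subseteq> {j<..}" if "A \<in> G" for A using Gs that by blast
  have fF: "(\<forall>A\<in>F. A \<subseteq> {1..length u} \<and> card A = 2)" "pairwise disjnt F"
     "\<And>i j. {i, j} \<in> F \<Longrightarrow> letter u i = \<iota> (letter u j)" "\<And>A B. A \<in> F \<Longrightarrow> B \<in> F \<Longrightarrow> \<not> linked A B"
    using F unfolding folding_def by blast+
  have gG: "(\<forall>A\<in>G. A \<subseteq> {1..length u} \<and> card A = 2)" "pairwise disjnt G"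
     "\<And>i j. {i, j} \<in> G \<Longrightarrow> letter u i = \<iota> (letter u j)" "\<And>A B. A \<in> G \<Longrightarrow> B \<in> G \<Longrightarrow> \<not> linked A B"
    using G unfolding folding_def by blast+
  have "\<forall>A\<in>?H. A \<subseteq> {1..length u} \<and> card A = 2" using fF(1) gG(1) ij by auto
  moreover have "pairwise disjnt ?H"
  proof -
    have FG: "disjnt A B" if "A \<in> F" "B \<in> G" for A B
    proof -
      have "{i<..<j} \<inter> {j<..} = {}" by auto
      then show ?thesis using f[OF that(1)] g[OF that(2)] unfolding disjnt_def by blast
    qed
    have "disjnt {i,j} A" if "A \<in> F \<union> G" for A
    proof -
      have "{i,j} \<inter> {i<..<j} = {}" "{i,j} \<inter> {j<..} = {}" using ij by auto
      then show ?thesis using f[of A] g[of A] that unfolding disjnt_def by blast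
    qed
    moreover have "pairwise disjnt (F \<union> G)"
    proof (rule pairwiseI)
      fix A B assume "A \<in> F \<union> G" "B \<in> F \<union> G" "A \<noteq> B"
      then show "disjnt A B"
        using FG[of A B] FG[of B A, THEN disjnt_sym] pairwiseD[OF fF(2), of A B]
          pairwiseD[OF gG(2), of A B] by blast
    qed
    ultimately show ?thesis by (simp add: pairwise_insert disjnt_sym)
  qed
  moreover have "letter u a = \<iota> (letter u b)" if "{a, b} \<in> ?H" for a b
  proof -
    from that consider "{a, b} = {i, j}" | "{a, b} \<in> F" | "{a, b} \<in> G" by blast
    then show ?thesis
    proof cases
      case 1 then show ?thesis using l by (metis doubleton_eq_iff)
    qed (rule fF(3) gG(3), assumption)+
  qed
  moreover have "\<not> linked A B" if "A \<in> ?H" "B \<in> ?H" for A B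
  proof -
    have 1: "\<not> linked A B" "\<not> linked B A" if "A \<in> insert {i,j} F" "B \<in> G" for A B
    proof -
      have "{i<..<j} \<subseteq> {..<Suc j}" "{i,j} \<subseteq> {..<Suc j}" "{j<..} \<subseteq> {Suc j..}" using ij by auto
      then have "A \<subseteq> {..<Suc j}" "B \<subseteq> {Suc j..}" using f[of A] g[of B] that by blast+
      then show "\<not> linked A B" "\<not> linked B A" by (rule not_linked_separated)+
    qed
    have 2: "\<not> linked A {i,j}" "\<not> linked {i,j} A" if "A \<in> F" for A
      using not_linked_nested[OF f[OF that]] .
    have 3: "\<not> linked {i,j} {i,j}"
      unfolding linked_def by (metis doubleton_eq_iff less_irrefl less_asym)
    show ?thesis
      using that by (elim insertE UnE) (simp_all add: 1 2 3 fF(4) gG(4))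
  qed
  ultimately show ?thesis unfolding folding_def by blast
qed

text \<open>The pair leaves \<open>j\<close> positions between its elements and \<open>k-1-j\<close>
  behind them, which with the pair itself make up all \<open>k+1\<close>. \<open>U\<close> and
  \<open>V\<close> will be the positions covered by the foldings of the two parts.\<close>

lemma interval_split:
  fixes U V :: "nat set"
  assumes "j < k" "U \<subseteq> {i+1<..<i+2+j}" "V \<subseteq> {i+2+j<..i+1+k}"
  shows "{i+1, i+2+j} \<union> U \<union> V \<subseteq> {i+1..i+Suc k}"
    and "{i+1..i+Suc k} - ({i+1, i+2+j} \<union> U \<union> V) =
      ({Suc i+1..Suc i+j} - U) \<union> ({i+2+j+1..i+2+j+(k-1-j)} - V)"
proof -
  have U: "x \<in> U \<Longrightarrow> i + 1 < x \<and> x < i + 2 + j" for x using assms(2) by auto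
  have V: "x \<in> V \<Longrightarrow> i + 2 + j < x \<and> x \<le> i + 1 + k" for x using assms(3) by auto
  show "{i+1, i+2+j} \<union> U \<union> V \<subseteq> {i+1..i+Suc k}" using U V assms(1) by force
  have "x \<in> {i+1..i+Suc k} - ({i+1, i+2+j} \<union> U \<union> V) \<longleftrightarrow>
      x \<in> ({Suc i+1..Suc i+j} - U) \<union> ({i+2+j+1..i+2+j+(k-1-j)} - V)" for x
    using U[of x] V[of x] assms(1) by (cases "x \<in> U"; cases "x \<in> V") auto
  then show "{i+1..i+Suc k} - ({i+1, i+2+j} \<union> U \<union> V) =
      ({Suc i+1..Suc i+j} - U) \<union> ({i+2+j+1..i+2+j+(k-1-j)} - V)" by blast
qed

lemma within_bounds:
  assumes "j < k" "F \<in> foldings_within \<iota> u (Suc i) j" "G \<in> foldings_within \<iota> u (i+2+j) (k-1-j)"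
  shows "\<Union>F \<subseteq> {i+1<..<i+2+j}" "\<Union>G \<subseteq> {i+2+j<..i+1+k}"
proof -
  have "\<Union>F \<subseteq> {Suc i+1..Suc i+j}" "\<Union>G \<subseteq> {i+2+j+1..i+2+j+(k-1-j)}"
    using assms(2,3) by (simp_all add: foldings_within_def)
  moreover have "{Suc i+1..Suc i+j} \<subseteq> {i+1<..<i+2+j}"
    "{i+2+j+1..i+2+j+(k-1-j)} \<subseteq> {i+2+j<..i+1+k}" using assms(1) by auto
  ultimately show "\<Union>F \<subseteq> {i+1<..<i+2+j}" "\<Union>G \<subseteq> {i+2+j<..i+1+k}" by blast+
qed

lemma unpaired_weight_within_insert_pair:
  assumes "j < k" "\<Union>F \<subseteq> {i+1<..<i+2+j}" "\<Union>G \<subseteq> {i+2+j<..i+1+k}"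
  shows "unpaired_weight_within wt u i (Suc k) (insert {i+1, i+2+j} (F \<union> G)) =
    unpaired_weight_within wt u (Suc i) j F + unpaired_weight_within wt u (i+2+j) (k-1-j) G"
proof -
  have "\<Union>(insert {i+1, i+2+j} (F \<union> G)) = {i+1, i+2+j} \<union> \<Union>F \<union> \<Union>G" by blast
  moreover have "({Suc i+1..Suc i+j} - \<Union>F) \<inter> ({i+2+j+1..i+2+j+(k-1-j)} - \<Union>G) = {}" by auto
  ultimately show ?thesis
    unfolding unpaired_weight_within_def
    by (simp only: interval_split(2)[OF assms] sum.union_disjoint finite_Diff finite_atLeastAtMost)
qed

text \<open>The first position is unpaired, or it is paired with the position \<open>j + 1\<close> places further on.\<close>

lemma opt_Suc:
  assumes inv: "\<And>x. x \<in> set u \<Longrightarrow> \<iota> (\<iota> x) = x" and len: "i + Suc k \<le> length u"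
  shows "opt \<iota> wt u i (Suc k) = Min (insert (wt (u ! i) + opt \<iota> wt u (Suc i) k)
    ((\<lambda>j. opt \<iota> wt u (Suc i) j + opt \<iota> wt u (i + 2 + j) (k - 1 - j)) `
      {j. j < k \<and> u ! i = \<iota> (u ! (i + 1 + j))}))" (is "_ = Min ?R")
proof (rule antisym)
  let ?W = "unpaired_weight_within wt u"
  have fin: "finite ?R" by simp
  \<comment> \<open>Each candidate is the weight of an actual folding, assembled from optimal
    foldings of the parts.\<close>
  show "opt \<iota> wt u i (Suc k) \<le> Min ?R"
  proof (rule Min.boundedI[OF fin])
    fix r assume "r \<in> ?R"
    then consider "r = wt (u ! i) + opt \<iota> wt u (Suc i) k"
      | j where "j < k" "u ! i = \<iota> (u ! (i + 1 + j))"
          "r = opt \<iota> wt u (Suc i) j + opt \<iota> wt u (i + 2 + j) (k - 1 - j)" by blast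
    then show "opt \<iota> wt u i (Suc k) \<le> r"
    proof cases
      case 1
      obtain F where F: "F \<in> foldings_within \<iota> u (Suc i) k" "opt \<iota> wt u (Suc i) k = ?W (Suc i) k F"
        by (rule opt_attained)
      have s: "\<Union>F \<subseteq> {Suc i+1..Suc i+k}" using F(1) by (simp add: foldings_within_def)
      have "F \<in> foldings_within \<iota> u i (Suc k)"
        using F(1) subset_trans[OF s, of "{i+1..i+Suc k}"] by (simp add: foldings_within_def)
      then have "opt \<iota> wt u i (Suc k) \<le> ?W i (Suc k) F" by (rule opt_le)
      also have "{i+1..i+Suc k} - \<Union>F = insert (Suc i) ({Suc i+1..Suc i+k} - \<Union>F)"
        using s by auto
      then have "?W i (Suc k) F = wt (u ! i) + ?W (Suc i) k F"
        by (simp add: unpaired_weight_within_def letter_def)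
      finally show ?thesis using 1 F(2) by simp
    next
      case 2
      obtain F where F: "F \<in> foldings_within \<iota> u (Suc i) j" "opt \<iota> wt u (Suc i) j = ?W (Suc i) j F"
        by (rule opt_attained)
      obtain G where G: "G \<in> foldings_within \<iota> u (i+2+j) (k-1-j)"
          "opt \<iota> wt u (i+2+j) (k-1-j) = ?W (i+2+j) (k-1-j) G"
        by (rule opt_attained)
      define H where "H = insert {i+1, i+2+j} (F \<union> G)"
      have s: "\<Union>F \<subseteq> {i+1<..<i+2+j}" "\<Union>G \<subseteq> {i+2+j<..i+1+k}"
        using within_bounds[OF 2(1) F(1) G(1)] .
      have "folding \<iota> u H" unfolding H_def
      proof (rule folding_insert_pair)
        show "letter u (i+1) = \<iota> (letter u (i+2+j))" using 2(2) by (simp add: letter_def)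
        \<comment> \<open>The reverse direction applies \<open>\<iota>\<close> to both sides; this
          is where the involution law enters.\<close>
        then show "letter u (i+2+j) = \<iota> (letter u (i+1))"
          using inv[of "u ! (i+1+j)"] 2(1) len by (simp add: letter_def)
        show "folding \<iota> u F" "folding \<iota> u G" using F(1) G(1) by (simp_all add: foldings_within_def)
        show "\<Union>G \<subseteq> {i+2+j<..}" using s(2) by fastforce
      qed (use s(1) 2(1) len in simp_all)
      moreover have "\<Union>H \<subseteq> {i+1..i+Suc k}"
        using interval_split(1)[OF 2(1) s] unfolding H_def by blast
      ultimately have "H \<in> foldings_within \<iota> u i (Suc k)"
        unfolding foldings_within_def by blast
      then have "opt \<iota> wt u i (Suc k) \<le> ?W i (Suc k) H" by (rule opt_le)
      also have "\<dots> = ?W (Suc i) j F + ?W (i+2+j) (k-1-j) G"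
        unfolding H_def by (rule unpaired_weight_within_insert_pair[OF 2(1) s])
      finally show ?thesis using 2 F(2) G(2) by simp
    qed
  qed blast
  \<comment> \<open>Conversely, an optimal \<open>H\<close> is taken apart according to the fate of
    position \<open>i + 1\<close>; replacing its parts by optimal ones can only lower the
    weight.\<close>
  show "Min ?R \<le> opt \<iota> wt u i (Suc k)"
  proof -
    obtain H where H: "H \<in> foldings_within \<iota> u i (Suc k)" "opt \<iota> wt u i (Suc k) = ?W i (Suc k) H"
      by (rule opt_attained)
    have fold: "folding \<iota> u H" and sub: "\<Union>H \<subseteq> {i+1..i+Suc k}"
      using H(1) by (auto simp: foldings_within_def)
    have "\<exists>r\<in>?R. r \<le> ?W i (Suc k) H"
    proof (cases "i + 1 \<in> \<Union>H")
      case False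
      have "x \<in> {Suc i+1..Suc i+k}" if "x \<in> \<Union>H" for x
        using subsetD[OF sub that] that False by (cases "x = i + 1") auto
      then have "\<Union>H \<subseteq> {Suc i+1..Suc i+k}" by blast
      then have "H \<in> foldings_within \<iota> u (Suc i) k" using fold by (simp add: foldings_within_def)
      then have "opt \<iota> wt u (Suc i) k \<le> ?W (Suc i) k H" by (rule opt_le)
      moreover have "{i+1..i+Suc k} - \<Union>H = insert (Suc i) ({Suc i+1..Suc i+k} - \<Union>H)"
        using False by auto
      then have "?W i (Suc k) H = wt (u ! i) + ?W (Suc i) k H"
        by (simp add: unpaired_weight_within_def letter_def)
      ultimately show ?thesis by auto
    next
      case True
      then obtain P where P: "P \<in> H" "i + 1 \<in> P" by blast
      have "card P = 2" by (rule foldingD[OF fold P(1)])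
      then obtain y where y: "P = {i+1, y}" "y \<noteq> i + 1"
      proof -
        obtain a b where "P = {a, b}" "a \<noteq> b" using \<open>card P = 2\<close> unfolding card_2_iff by blast
        then show ?thesis using that[of b] that[of a] P(2) by (cases "a = i + 1") auto
      qed
      have "y \<in> {i+1..i+Suc k}" using sub P(1) y(1) by blast
      then obtain j where j: "y = i+2+j" "j < k"
        using y(2) by (intro that[of "y - (i+2)"]) auto
      define F where "F = {A\<in>H. A \<subseteq> {i+1<..<y}}"
      define G where "G = {A\<in>H. A \<subseteq> {y<..}}"
      \<comment> \<open>Any other pair lies beyond \<open>i + 1\<close>; with \<open>y\<close>
        strictly between its elements it would be linked to \<open>P\<close>, so it lies on one side
        of \<open>y\<close>.\<close>
      have eq: "H = insert P (F \<union> G)"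
      proof -
        have "A \<in> F \<union> G" if A: "A \<in> H" "A \<noteq> P" for A
        proof -
          have "disjnt A P" using fold A P(1) unfolding folding_def pairwise_def by blast
          then have ny: "i + 1 \<notin> A" "y \<notin> A" using y by (auto simp: disjnt_def)
          have "card A = 2" by (rule foldingD[OF fold A(1)])
          then obtain a b where ab: "A = {a, b}" "a < b"
          proof -
            obtain c d where "A = {c, d}" "c \<noteq> d" using \<open>card A = 2\<close> unfolding card_2_iff by blast
            then show ?thesis using that[of c d] that[of d c] by (cases "c < d") auto
          qed
          have "a \<ge> i+1" "b \<ge> i+1" using sub A(1) ab by auto
          then have gt: "a > i+1" "b > i+1" using ny ab by (auto simp: le_eq_less_or_eq)
          have "\<not> linked P A" using fold A(1) P(1) unfolding folding_def by blast
          moreover have "linked P A" if "a < y" "y < b"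
            unfolding linked_def
            by (rule exI[of _ "i + 1"], rule exI[of _ y], rule exI[of _ a], rule exI[of _ b])
              (use that y(1) ab gt j in auto)
          ultimately have "\<not> (a < y \<and> y < b)" by blast
          then have "A \<subseteq> {i+1<..<y} \<or> A \<subseteq> {y<..}" using gt ny ab by auto
          then show ?thesis using A(1) by (auto simp: F_def G_def)
        qed
        then show ?thesis using P(1) by (auto simp: F_def G_def)
      qed
      have F: "F \<in> foldings_within \<iota> u (Suc i) j"
        using folding_subset[OF fold, of F] j by (auto simp: foldings_within_def F_def)
      have "x \<in> {i+2+j+1..i+2+j+(k-1-j)}" if "x \<in> \<Union>G" for x
        using subsetD[OF sub, of x] that j by (auto simp: G_def)
      then have "\<Union>G \<subseteq> {i+2+j+1..i+2+j+(k-1-j)}" by blast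
      then have G: "G \<in> foldings_within \<iota> u (i+2+j) (k-1-j)"
        using folding_subset[OF fold, of G] by (simp add: foldings_within_def G_def)
      have s: "\<Union>F \<subseteq> {i+1<..<i+2+j}" "\<Union>G \<subseteq> {i+2+j<..i+1+k}"
        using within_bounds[OF j(2) F G] .
      have "?W i (Suc k) H = ?W (Suc i) j F + ?W (i+2+j) (k-1-j) G"
        unfolding eq y(1) j(1) by (rule unpaired_weight_within_insert_pair[OF j(2) s])
      moreover have "letter u (i+1) = \<iota> (letter u y)"
        using fold P(1) y(1) unfolding folding_def by blast
      then have "u ! i = \<iota> (u ! (i+1+j))" by (simp add: j letter_def)
      ultimately have "opt \<iota> wt u (Suc i) j + opt \<iota> wt u (i+2+j) (k-1-j) \<le> ?W i (Suc k) H"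
          "opt \<iota> wt u (Suc i) j + opt \<iota> wt u (i+2+j) (k-1-j) \<in> ?R"
        using opt_le[OF F, of wt] opt_le[OF G, of wt] j(2) by (linarith, blast)
      then show ?thesis by blast
    qed
    then obtain r where "r \<in> ?R" "r \<le> ?W i (Suc k) H" by blast
    then show ?thesis using Min_le[OF fin, of r] H(2) by linarith
  qed
qed

section \<open>Reduction of the distance to optima of intervals\<close>

lemma opt_whole: "opt \<iota> wt u 0 (length u) = Min (unpaired_weight wt u ` {F. folding \<iota> u F})"
proof -
  have "foldings_within \<iota> u 0 (length u) = {F. folding \<iota> u F}"
    using foldingD(1) unfolding foldings_within_def
    by (intro Collect_cong) (simp only: add_0 Sup_le_iff, blast)
  then show ?thesis by (simp add: opt_def unpaired_weight_within_def unpaired_weight_def)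
qed

lemma length_mixed_word: "length (mixed_word \<iota> w1 w2 p q) = length w1 + length w2"
  by (simp add: mixed_word_def)

text \<open>A minimum over triples is an iterated minimum. For fixed \<open>(p, q)\<close> the inner
  one is attained, since the foldings form a finite set that contains the empty folding.\<close>

lemma cancellation_distance_eq_Min_opt:
  assumes "w1 \<noteq> []" "w2 \<noteq> []"
  shows "cancellation_distance \<iota> wt w1 w2 =
    Min ((\<lambda>(p, q). opt \<iota> wt (mixed_word \<iota> w1 w2 p q) 0 (length w1 + length w2)) `
      ({..<length w1} \<times> {..<length w2}))" (is "_ = Min (?g ` ?D)")
proof (rule antisym)
  let ?u = "mixed_word \<iota> w1 w2" and ?f = "\<lambda>(F, p, q). unpaired_weight wt (mixed_word \<iota> w1 w2 p q) F"
  have g: "?g (p, q) = Min (unpaired_weight wt (?u p q) ` {F. folding \<iota> (?u p q) F})" for p q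
    using opt_whole[of \<iota> wt "?u p q"] by (simp add: length_mixed_word)
  have fin: "finite {F. folding \<iota> (?u p q) F}" for p q
    by (rule finite_subset[of _ "Pow (Pow {1..length (?u p q)})"]) (use foldingD(1) in blast, simp)
  have ne: "{F. folding \<iota> (?u p q) F} \<noteq> {}" for p q using folding_empty by blast
  have D: "finite (?g ` ?D)" "?g ` ?D \<noteq> {}" using assms by auto
  show "cancellation_distance \<iota> wt w1 w2 \<le> Min (?g ` ?D)"
  proof (rule Min.boundedI[OF D])
    fix r assume "r \<in> ?g ` ?D"
    then obtain p q where pq: "p < length w1" "q < length w2" "r = ?g (p, q)" by auto
    have "?g (p, q) \<in> unpaired_weight wt (?u p q) ` {F. folding \<iota> (?u p q) F}"
      unfolding g by (intro Min_in) (use fin ne in auto)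
    then obtain F where F: "folding \<iota> (?u p q) F" "r = unpaired_weight wt (?u p q) F"
      using pq(3) by auto
    then have "r \<in> ?f ` mixed_foldings \<iota> w1 w2"
      using pq by (intro image_eqI[of _ _ "(F, p, q)"]) (auto simp: mixed_foldings_def)
    then show "cancellation_distance \<iota> wt w1 w2 \<le> r"
      unfolding cancellation_distance_def by (intro Min_le) (auto simp: finite_mixed_foldings)
  qed
  show "Min (?g ` ?D) \<le> cancellation_distance \<iota> wt w1 w2"
    unfolding cancellation_distance_def
  proof (rule Min.boundedI)
    fix r assume "r \<in> ?f ` mixed_foldings \<iota> w1 w2"
    then obtain F p q where pq: "p < length w1" "q < length w2" "folding \<iota> (?u p q) F"
      "r = unpaired_weight wt (?u p q) F" by (auto simp: mixed_foldings_def)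
    have "Min (?g ` ?D) \<le> ?g (p, q)" using pq D by (intro Min_le) auto
    also have "\<dots> \<le> r" unfolding g pq(4) by (intro Min_le) (use fin pq in auto)
    finally show "Min (?g ` ?D) \<le> r" .
  qed (use mixed_foldings_nonempty[OF assms] in \<open>auto simp: finite_mixed_foldings\<close>)
qed


section \<open>Total correctness with time and space bounds\<close>

text \<open>The defining equations fire only on explicit triples; the projected form lets
  simplification compute value, time and cells of any concrete expression.\<close>

lemma result_sel [simp]:
  "fst (op1 f r) = f (fst r)" "fst (snd (op1 f r)) = fst (snd r) + 1" "snd (snd (op1 f r)) = snd (snd r)"
  "fst (op2 g r s) = g (fst r) (fst s)"
  "fst (snd (op2 g r s)) = fst (snd r) + fst (snd s) + 1"
  "snd (snd (op2 g r s)) = snd (snd r) \<union> snd (snd s)"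
  "fst (fetch c mem x) = mem (fst x)" "fst (snd (fetch c mem x)) = fst (snd x) + 1"
  "snd (snd (fetch c mem x)) = insert (c (fst x)) (snd (snd x))"
  by (cases r; cases s; cases x; simp)+

definition For :: "nat \<Rightarrow> iexp \<Rightarrow> com \<Rightarrow> com" where
  "For v e c = Seq (ISet (IConst v) (IConst 0))
     (While (ILess (IGet (IConst v)) e) (Seq c (ISet (IConst v) (IAdd (IGet (IConst v)) (IConst 1)))))"

locale resources =
  fixes M :: nat and \<iota> :: "'a \<Rightarrow> 'a" and wt :: "'a \<Rightarrow> real" and X :: "cell set"
begin

text \<open>A total correctness triple; runs being unique, one good run is the run. Time is an upper
  bound that the rules add up, while the cells are confined to the set \<open>X\<close> of the
  locale, so that no rule has to combine space bounds.\<close>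

definition halts :: "com \<Rightarrow> 'a memory \<Rightarrow> nat \<Rightarrow> ('a memory \<Rightarrow> bool) \<Rightarrow> bool" where
  "halts c \<sigma> T Q \<longleftrightarrow> (\<exists>t Y \<sigma>'. exec M \<iota> wt c \<sigma> t Y \<sigma>' \<and> t \<le> T \<and> Y \<subseteq> X \<and> Q \<sigma>')"

lemma halts_mono:
  "halts c \<sigma> T Q \<Longrightarrow> T \<le> T' \<Longrightarrow> (\<And>\<sigma>'. Q \<sigma>' \<Longrightarrow> Q' \<sigma>') \<Longrightarrow> halts c \<sigma> T' Q'"
  unfolding halts_def by (meson order_trans)

lemma halts_Skip: "1 \<le> T \<Longrightarrow> Q \<sigma> \<Longrightarrow> halts Skip \<sigma> T Q"
  unfolding halts_def by (meson exec.Skip empty_subsetI)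

lemma halts_ISet:
  assumes "fst (ieval \<sigma> e) \<le> M" "fst (snd (ieval \<sigma> a)) + fst (snd (ieval \<sigma> e)) + 1 \<le> T"
    "insert (ICell (fst (ieval \<sigma> a))) (snd (snd (ieval \<sigma> a)) \<union> snd (snd (ieval \<sigma> e))) \<subseteq> X"
    "Q (\<sigma>\<lparr>imem := (imem \<sigma>)(fst (ieval \<sigma> a) := fst (ieval \<sigma> e))\<rparr>)"
  shows "halts (ISet a e) \<sigma> T Q"
proof -
  obtain i t Y v u Z where e: "ieval \<sigma> a = (i, t, Y)" "ieval \<sigma> e = (v, u, Z)"
    by (metis prod.collapse)
  from exec.ISet[OF e, of M \<iota> wt] show ?thesis
    unfolding halts_def using assms e by (intro exI conjI) auto
qed

lemma halts_LSet:
  assumes "fst (snd (ieval \<sigma> a)) + fst (snd (leval \<iota> \<sigma> e)) + 1 \<le> T"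
    "insert (LCell (fst (ieval \<sigma> a))) (snd (snd (ieval \<sigma> a)) \<union> snd (snd (leval \<iota> \<sigma> e))) \<subseteq> X"
    "Q (\<sigma>\<lparr>lmem := (lmem \<sigma>)(fst (ieval \<sigma> a) := fst (leval \<iota> \<sigma> e))\<rparr>)"
  shows "halts (LSet a e) \<sigma> T Q"
proof -
  obtain i t Y v u Z where e: "ieval \<sigma> a = (i, t, Y)" "leval \<iota> \<sigma> e = (v, u, Z)"
    by (metis prod.collapse)
  from exec.LSet[OF e, of M wt] show ?thesis
    unfolding halts_def using assms e by (intro exI conjI) auto
qed

lemma halts_WSet:
  assumes "fst (snd (ieval \<sigma> a)) + fst (snd (weval \<iota> wt \<sigma> e)) + 1 \<le> T"
    "insert (WCell (fst (ieval \<sigma> a))) (snd (snd (ieval \<sigma> a)) \<union> snd (snd (weval \<iota> wt \<sigma> e))) \<subseteq> X"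
    "Q (\<sigma>\<lparr>wmem := (wmem \<sigma>)(fst (ieval \<sigma> a) := fst (weval \<iota> wt \<sigma> e))\<rparr>)"
  shows "halts (WSet a e) \<sigma> T Q"
proof -
  obtain i t Y v u Z where e: "ieval \<sigma> a = (i, t, Y)" "weval \<iota> wt \<sigma> e = (v, u, Z)"
    by (metis prod.collapse)
  from exec.WSet[OF e, of M] show ?thesis
    unfolding halts_def using assms e by (intro exI conjI) auto
qed

lemma halts_Seq:
  assumes "halts c \<sigma> T R" "\<And>\<sigma>'. R \<sigma>' \<Longrightarrow> halts d \<sigma>' T' Q"
  shows "halts (Seq c d) \<sigma> (T + T') Q"
proof -
  obtain t Y \<sigma>1 where c: "exec M \<iota> wt c \<sigma> t Y \<sigma>1" "t \<le> T" "Y \<subseteq> X" "R \<sigma>1"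
    using assms(1) unfolding halts_def by blast
  obtain u Z \<sigma>2 where d: "exec M \<iota> wt d \<sigma>1 u Z \<sigma>2" "u \<le> T'" "Z \<subseteq> X" "Q \<sigma>2"
    using assms(2)[OF c(4)] unfolding halts_def by blast
  have "t + u \<le> T + T'" "Y \<union> Z \<subseteq> X" using c d by auto
  then show ?thesis using exec.Seq[OF c(1) d(1)] d(4) unfolding halts_def by blast
qed

lemma halts_Cond:
  assumes "snd (snd (beval \<iota> wt \<sigma> b)) \<subseteq> X"
    "fst (beval \<iota> wt \<sigma> b) \<Longrightarrow> halts c \<sigma> T Q"
    "\<not> fst (beval \<iota> wt \<sigma> b) \<Longrightarrow> halts d \<sigma> T Q"
    "fst (snd (beval \<iota> wt \<sigma> b)) + T + 1 \<le> T'"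
  shows "halts (Cond b c d) \<sigma> T' Q"
proof -
  obtain v t Y where b: "beval \<iota> wt \<sigma> b = (v, t, Y)" by (metis prod.collapse)
  have *: "\<exists>u Z \<sigma>'. exec M \<iota> wt (if v then c else d) \<sigma> u Z \<sigma>' \<and> u \<le> T \<and> Z \<subseteq> X \<and> Q \<sigma>'"
    using assms(2,3) b by (cases v) (simp_all add: halts_def)
  then obtain u Z \<sigma>' where e: "exec M \<iota> wt (if v then c else d) \<sigma> u Z \<sigma>'" "u \<le> T" "Z \<subseteq> X" "Q \<sigma>'"
    by blast
  have "exec M \<iota> wt (Cond b c d) \<sigma> (t + u + 1) (Y \<union> Z) \<sigma>'"
    using e(1) b exec.CondTrue[of \<iota> wt \<sigma> b t Y] exec.CondFalse[of \<iota> wt \<sigma> b t Y]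
    by (cases v) simp_all
  moreover have "t + u + 1 \<le> T'" "Y \<union> Z \<subseteq> X" using assms(1,4) b e by auto
  ultimately show ?thesis using e(4) unfolding halts_def by blast
qed

text \<open>The measure \<open>r\<close> also counts rounds: each round lowers it by at least 1,
  which frees the \<open>Tg + Tb + 1\<close> steps that pay for the round. The final
  \<open>Tg + 1\<close> pays for the guard that fails.\<close>

lemma halts_While:
  assumes "\<And>\<sigma>. I \<sigma> \<Longrightarrow> snd (snd (beval \<iota> wt \<sigma> b)) \<subseteq> X \<and> fst (snd (beval \<iota> wt \<sigma> b)) \<le> Tg"
    and "\<And>\<sigma>. I \<sigma> \<Longrightarrow> fst (beval \<iota> wt \<sigma> b) \<Longrightarrow> halts c \<sigma> Tb (\<lambda>\<sigma>'. I \<sigma>' \<and> r \<sigma>' < r \<sigma>)"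
    and "I \<sigma>"
  shows "halts (While b c) \<sigma> (r \<sigma> * (Tg + Tb + 1) + Tg + 1) (\<lambda>\<sigma>'. I \<sigma>' \<and> \<not> fst (beval \<iota> wt \<sigma>' b))"
  using \<open>I \<sigma>\<close>
proof (induction "r \<sigma>" arbitrary: \<sigma> rule: less_induct)
  case less
  obtain v t Y where b: "beval \<iota> wt \<sigma> b = (v, t, Y)" by (metis prod.collapse)
  have g: "t \<le> Tg" "Y \<subseteq> X" using assms(1)[OF less.prems] b by auto
  show ?case
  proof (cases v)
    case True
    obtain u Z \<sigma>1 where e: "exec M \<iota> wt c \<sigma> u Z \<sigma>1" "u \<le> Tb" "Z \<subseteq> X" "I \<sigma>1" "r \<sigma>1 < r \<sigma>"
      using assms(2)[OF less.prems] b True unfolding halts_def by auto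
    obtain x V \<sigma>2 where f: "exec M \<iota> wt (While b c) \<sigma>1 x V \<sigma>2" "V \<subseteq> X"
        "x \<le> r \<sigma>1 * (Tg + Tb + 1) + Tg + 1" "I \<sigma>2 \<and> \<not> fst (beval \<iota> wt \<sigma>2 b)"
      using less.hyps[OF e(5,4)] unfolding halts_def by blast
    have "(r \<sigma>1 + 1) * (Tg + Tb + 1) \<le> r \<sigma> * (Tg + Tb + 1)" using e(5) by (intro mult_le_mono1) simp
    then have "t + u + x + 1 \<le> r \<sigma> * (Tg + Tb + 1) + Tg + 1" using f(3) g e(2) by simp
    moreover have "exec M \<iota> wt (While b c) \<sigma> (t + u + x + 1) (Y \<union> Z \<union> V) \<sigma>2"
      using exec.WhileTrue[OF _ e(1) f(1)] b True by simp
    moreover have "Y \<union> Z \<union> V \<subseteq> X" using g e f by blast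
    ultimately show ?thesis using f(4) unfolding halts_def by blast
  next
    case False
    then have "exec M \<iota> wt (While b c) \<sigma> (t + 1) Y \<sigma>" using exec.WhileFalse[of \<iota> wt \<sigma> b t Y] b by simp
    moreover have "t + 1 \<le> r \<sigma> * (Tg + Tb + 1) + Tg + 1" using g by simp
    moreover have "I \<sigma> \<and> \<not> fst (beval \<iota> wt \<sigma> b)" using b False less.prems by simp
    ultimately show ?thesis using g(2) unfolding halts_def by blast
  qed
qed

text \<open>An iteration costs at most 18 steps besides the body: 11 for the guard, 1 for \<^const>\<open>While\<close> and 6 for the increment.\<close>

lemma halts_For:
  assumes init: "I 0 (\<sigma>\<lparr>imem := (imem \<sigma>)(v := 0)\<rparr>)"
    and bound: "\<And>k \<sigma>. I k \<sigma> \<Longrightarrow> imem \<sigma> v = k \<Longrightarrow>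
      fst (ieval \<sigma> e) = h \<and> fst (snd (ieval \<sigma> e)) \<le> 8 \<and> snd (snd (ieval \<sigma> e)) \<subseteq> X"
    and body: "\<And>k \<sigma>. k < h \<Longrightarrow> I k \<sigma> \<Longrightarrow> imem \<sigma> v = k \<Longrightarrow>
      halts c \<sigma> Tb (\<lambda>\<sigma>'. imem \<sigma>' v = k \<and> I (Suc k) (\<sigma>'\<lparr>imem := (imem \<sigma>')(v := Suc k)\<rparr>))"
    and fin: "\<And>\<sigma>. I h \<sigma> \<Longrightarrow> imem \<sigma> v = h \<Longrightarrow> Q \<sigma>"
    and h: "h < s" "h \<le> M" "ICell v \<in> X"
  shows "halts (For v e c) \<sigma> (s * (Tb + 18)) Q"
proof -
  let ?b = "ILess (IGet (IConst v)) e"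
  let ?c = "Seq c (ISet (IConst v) (IAdd (IGet (IConst v)) (IConst 1)))"
  let ?J = "\<lambda>\<sigma>. imem \<sigma> v \<le> h \<and> I (imem \<sigma> v) \<sigma>"
  have w: "halts (While ?b ?c) \<sigma> ((h - imem \<sigma> v) * (11 + (Tb + 6) + 1) + 11 + 1)
      (\<lambda>\<sigma>'. ?J \<sigma>' \<and> \<not> fst (beval \<iota> wt \<sigma>' ?b))" if "?J \<sigma>" for \<sigma>
  proof (rule halts_While[where r = "\<lambda>\<sigma>. h - imem \<sigma> v"])
    \<comment> \<open>Reading the counter costs 2 and comparing costs 1; the remaining 8 are the
      price of \<open>ISub len_exp (reg 4)\<close>, the most expensive loop bound of the
      program.\<close>
    fix \<sigma> assume "?J \<sigma>"
    then show "snd (snd (beval \<iota> wt \<sigma> ?b)) \<subseteq> X \<and> fst (snd (beval \<iota> wt \<sigma> ?b)) \<le> 11"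
      using bound[of "imem \<sigma> v" \<sigma>] h by simp
  next
    fix \<sigma> assume J: "?J \<sigma>" and "fst (beval \<iota> wt \<sigma> ?b)"
    then have lt: "imem \<sigma> v < h" using bound[of "imem \<sigma> v" \<sigma>] by simp
    show "halts ?c \<sigma> (Tb + 6) (\<lambda>\<sigma>'. ?J \<sigma>' \<and> h - imem \<sigma>' v < h - imem \<sigma> v)"
      by (rule halts_Seq[OF body[OF lt, of \<sigma>]], use J in simp, simp, rule halts_ISet)
        (use lt h in auto)
  qed (use that in simp)
  \<comment> \<open>Initialisation takes 3 steps and the failing guard 12; one spare round, granted
    by \<open>h < s\<close>, covers both.\<close>
  have "(h + 1) * (Tb + 18) \<le> s * (Tb + 18)" using h(1) by (intro mult_le_mono1) simp
  then have "3 + (h * (11 + (Tb + 6) + 1) + 11 + 1) \<le> s * (Tb + 18)" by (simp add: add.commute)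
  moreover have "halts (For v e c) \<sigma> (3 + (h * (11 + (Tb + 6) + 1) + 11 + 1)) Q"
    unfolding For_def
  proof (rule halts_Seq[where R = "\<lambda>\<sigma>. imem \<sigma> v = 0 \<and> I 0 \<sigma>"])
    show "halts (ISet (IConst v) (IConst 0)) \<sigma> 3 (\<lambda>\<sigma>. imem \<sigma> v = 0 \<and> I 0 \<sigma>)"
      by (rule halts_ISet) (use init h in simp_all)
  next
    fix \<sigma> assume "imem \<sigma> v = 0 \<and> I 0 \<sigma>"
    then have "halts (While ?b ?c) \<sigma> (h * (11 + (Tb + 6) + 1) + 11 + 1)
        (\<lambda>\<sigma>'. ?J \<sigma>' \<and> \<not> fst (beval \<iota> wt \<sigma>' ?b))"
      using w[of \<sigma>] by simp
    then show "halts (While ?b ?c) \<sigma> (h * (11 + (Tb + 6) + 1) + 11 + 1) Q"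
    proof (rule halts_mono[OF _ order_refl])
      fix \<sigma>' assume J: "?J \<sigma>' \<and> \<not> fst (beval \<iota> wt \<sigma>' ?b)"
      then have "imem \<sigma>' v = h" using bound[of "imem \<sigma>' v" \<sigma>'] by simp
      then show "Q \<sigma>'" using fin J by simp
    qed
  qed
  ultimately show ?thesis by (blast intro: halts_mono)
qed

end


section \<open>The program\<close>

text \<open>The row \<open>k\<close> is the length of an interval, the column \<open>i\<close> the
  number of letters before it, which ranges up to \<open>l\<close>. The shift by 1 keeps weight cell
  0 free for the running minimum over \<open>(p, q)\<close>.\<close>

definition cell :: "nat \<Rightarrow> nat \<Rightarrow> nat \<Rightarrow> nat" where
  "cell l k i = k * (l + 1) + i + 1"

lemma cell_eq_iff [simp]:
  assumes "i \<le> l" "i' \<le> l"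
  shows "cell l k i = cell l k' i' \<longleftrightarrow> k = k' \<and> i = i'"
proof
  assume "cell l k i = cell l k' i'"
  then have eq: "i + k * (l + 1) = i' + k' * (l + 1)" by (simp add: cell_def)
  have "k = (i + k * (l + 1)) div (l + 1)" "i = (i + k * (l + 1)) mod (l + 1)"
    using assms(1) by (simp_all only: div_mult_self1 mod_mult_self1) simp_all
  moreover have "k' = (i' + k' * (l + 1)) div (l + 1)" "i' = (i' + k' * (l + 1)) mod (l + 1)"
    using assms(2) by (simp_all only: div_mult_self1 mod_mult_self1) simp_all
  ultimately show "k = k' \<and> i = i'" using eq by metis
qed simp

lemma cell_neq_0 [simp]: "cell l k i \<noteq> 0" "0 < cell l k i"
  by (simp_all add: cell_def)

lemma cell_le: "k \<le> l \<Longrightarrow> i \<le> l \<Longrightarrow> cell l k i \<le> (l + 1)\<^sup>2"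
proof -
  assume "k \<le> l" "i \<le> l"
  then have "k * (l + 1) + i + 1 \<le> l * (l + 1) + l + 1" by (intro add_mono mult_le_mono1) auto
  then show ?thesis by (simp add: cell_def power2_eq_square algebra_simps)
qed

abbreviation reg :: "nat \<Rightarrow> iexp" where
  "reg v \<equiv> IGet (IConst v)"

definition len_exp :: iexp where
  "len_exp = IAdd (reg 0) (reg 1)"

definition cell_exp :: "iexp \<Rightarrow> iexp \<Rightarrow> iexp" where
  "cell_exp d e = IAdd (IAdd (IMul d (IAdd len_exp (IConst 1))) e) (IConst 1)"

definition word_exp :: "iexp \<Rightarrow> iexp" where
  "word_exp e = IAdd len_exp e"

lemma len_exp_sel [simp]:
  "fst (ieval \<sigma> len_exp) = imem \<sigma> 0 + imem \<sigma> 1"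
  "fst (snd (ieval \<sigma> len_exp)) = 5"
  "snd (snd (ieval \<sigma> len_exp)) = {ICell 0, ICell 1}"
  by (auto simp: len_exp_def)

lemma cell_exp_sel [simp]:
  "fst (ieval \<sigma> (cell_exp d e)) = cell (imem \<sigma> 0 + imem \<sigma> 1) (fst (ieval \<sigma> d)) (fst (ieval \<sigma> e))"
  "fst (snd (ieval \<sigma> (cell_exp d e))) = fst (snd (ieval \<sigma> d)) + fst (snd (ieval \<sigma> e)) + 11"
  "snd (snd (ieval \<sigma> (cell_exp d e))) =
     {ICell 0, ICell 1} \<union> snd (snd (ieval \<sigma> d)) \<union> snd (snd (ieval \<sigma> e))"
  by (auto simp: cell_exp_def cell_def)

lemma word_exp_sel [simp]:
  "fst (ieval \<sigma> (word_exp e)) = imem \<sigma> 0 + imem \<sigma> 1 + fst (ieval \<sigma> e)"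
  "fst (snd (ieval \<sigma> (word_exp e))) = fst (snd (ieval \<sigma> e)) + 6"
  "snd (snd (ieval \<sigma> (word_exp e))) = {ICell 0, ICell 1} \<union> snd (snd (ieval \<sigma> e))"
  by (simp_all add: word_exp_def)

text \<open>Number cells 2 and 3 hold \<open>p\<close> and \<open>q\<close>; cells 4, 5 and 6 are the counters of the inner loops.\<close>

definition copy_letter :: com where
  "copy_letter =
     Cond (ILess (IAdd (reg 2) (reg 4)) (reg 0))
       (LSet (word_exp (reg 4)) (LGet (IAdd (reg 2) (reg 4))))
     (Cond (ILess (reg 4) (reg 0))
       (LSet (word_exp (reg 4)) (LGet (ISub (IAdd (reg 2) (reg 4)) (reg 0))))
     (Cond (ILess (reg 4) (IAdd (reg 0) (reg 3)))
       (LSet (word_exp (reg 4))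
         (LInv (LGet (ISub (IAdd (reg 0) (IAdd (reg 0) (reg 3))) (IAdd (reg 4) (IConst 1))))))
       (LSet (word_exp (reg 4))
         (LInv (LGet (ISub (IAdd (reg 0) (IAdd len_exp (reg 3))) (IAdd (reg 4) (IConst 1))))))))"

text \<open>With \<open>k\<close>, \<open>i\<close>, \<open>j\<close> in number cells 4, 5, 6, this
  is the cost when the first letter is paired with the one \<open>j + 1\<close> places on. Cell 4
  holds the length minus one: the row being filled is \<open>k + 1\<close>, and the rows read are
  \<open>j\<close> and \<open>k - 1 - j\<close>.\<close>

definition split_exp :: wexp where
  "split_exp = WAdd (WGet (cell_exp (reg 6) (IAdd (reg 5) (IConst 1))))
     (WGet (cell_exp (ISub (ISub (reg 4) (IConst 1)) (reg 6)) (IAdd (IAdd (reg 5) (IConst 2)) (reg 6))))"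

definition improve :: com where
  "improve =
     Cond (BAnd (LEq (LGet (word_exp (reg 5)))
                     (LInv (LGet (word_exp (IAdd (IAdd (reg 5) (IConst 1)) (reg 6))))))
                (WLess split_exp (WGet (cell_exp (IAdd (reg 4) (IConst 1)) (reg 5)))))
       (WSet (cell_exp (IAdd (reg 4) (IConst 1)) (reg 5)) split_exp)
       Skip"

definition start_cell :: com where
  "start_cell = WSet (cell_exp (IAdd (reg 4) (IConst 1)) (reg 5))
     (WAdd (WOf (LGet (word_exp (reg 5)))) (WGet (cell_exp (reg 4) (IAdd (reg 5) (IConst 1)))))"

text \<open>
  Row 0 of the table is never written: its cells hold 0 from the start, the optimum of empty intervals.
\<close>

definition fill_table :: com where
  "fill_table = For 4 len_exp (For 5 (ISub len_exp (reg 4)) (Seq start_cell (For 6 (reg 4) improve)))"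

text \<open>Weight cell 0 holds no candidate yet when \<open>p = q = 0\<close>, so that its content is then ignored.\<close>

definition record_min :: com where
  "record_min =
     Cond (BAnd (BNot (ILess (IAdd (reg 2) (reg 3)) (IConst 1)))
                (BNot (WLess (WGet (cell_exp len_exp (IConst 0))) (WGet (IConst 0)))))
       Skip
       (WSet (IConst 0) (WGet (cell_exp len_exp (IConst 0))))"

definition distance_program :: com where
  "distance_program =
     For 2 (reg 0) (For 3 (reg 1) (Seq (For 4 len_exp copy_letter) (Seq fill_table record_min)))"

text \<open>Each of the four blocks is expressed by addresses into \<open>w1 @ w2\<close>, as the
  input is stored. The inverted blocks run backwards, so the address is a fixed sum minus
  \<open>Suc a\<close>; subtracting last keeps truncated subtraction exact.\<close>

lemma mixed_word_nth:
  assumes "p < length w1" "q < length w2"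
  shows "a + p < length w1 \<Longrightarrow> mixed_word \<iota> w1 w2 p q ! a = (w1 @ w2) ! (p + a)"
    and "length w1 \<le> a + p \<Longrightarrow> a < length w1 \<Longrightarrow>
      mixed_word \<iota> w1 w2 p q ! a = (w1 @ w2) ! (p + a - length w1)"
    and "length w1 \<le> a \<Longrightarrow> a < length w1 + q \<Longrightarrow>
      mixed_word \<iota> w1 w2 p q ! a = \<iota> ((w1 @ w2) ! (length w1 + (length w1 + q) - Suc a))"
    and "length w1 + q \<le> a \<Longrightarrow> a < length w1 + length w2 \<Longrightarrow>
      mixed_word \<iota> w1 w2 p q ! a = \<iota> ((w1 @ w2) ! (length w1 + (length w1 + length w2 + q) - Suc a))"
proof -
  show "a + p < length w1 \<Longrightarrow> mixed_word \<iota> w1 w2 p q ! a = (w1 @ w2) ! (p + a)"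
    by (auto simp: mixed_word_def nth_append less_diff_conv add.commute)
  show "length w1 \<le> a + p \<Longrightarrow> a < length w1 \<Longrightarrow>
      mixed_word \<iota> w1 w2 p q ! a = (w1 @ w2) ! (p + a - length w1)"
    using assms by (auto simp: mixed_word_def nth_append intro!: arg_cong[of _ _ "(!) w1"])
  show "length w1 \<le> a \<Longrightarrow> a < length w1 + q \<Longrightarrow>
      mixed_word \<iota> w1 w2 p q ! a = \<iota> ((w1 @ w2) ! (length w1 + (length w1 + q) - Suc a))"
    using assms by (auto simp: mixed_word_def nth_append rev_nth intro!: arg_cong[of _ _ \<iota>] arg_cong[of _ _ "(!) w2"])
  show "length w1 + q \<le> a \<Longrightarrow> a < length w1 + length w2 \<Longrightarrow>
      mixed_word \<iota> w1 w2 p q ! a = \<iota> ((w1 @ w2) ! (length w1 + (length w1 + length w2 + q) - Suc a))"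
    using assms by (auto simp: mixed_word_def nth_append rev_nth intro!: arg_cong[of _ _ \<iota>] arg_cong[of _ _ "(!) w2"])
qed

lemma set_mixed_word: "set (mixed_word \<iota> w1 w2 p q) \<subseteq> set w1 \<union> \<iota> ` set w2"
  by (auto simp: mixed_word_def dest: in_set_dropD in_set_takeD)

section \<open>Invariants of the run\<close>

locale distance_run =
  fixes M :: nat and \<iota> :: "'a \<Rightarrow> 'a" and wt :: "'a \<Rightarrow> real" and w1 w2 :: "'a list"
  assumes nonempty: "w1 \<noteq> []" "w2 \<noteq> []"
    and involution: "\<And>x. x \<in> set w1 \<union> set w2 \<Longrightarrow> \<iota> (\<iota> x) = x"
    and capacity: "length w1 + length w2 \<le> M"
begin

abbreviation "n \<equiv> length w1"
abbreviation "m \<equiv> length w2"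
abbreviation "L \<equiv> length w1 + length w2"
abbreviation "word \<equiv> mixed_word \<iota> w1 w2"

text \<open>Two lengths and five loop counters; the input followed by the current mixed word; the
  running minimum followed by a table with \<open>L + 1\<close> rows and columns.\<close>

definition allowed_cells :: "cell set" where
  "allowed_cells = ICell ` {..<7} \<union> LCell ` {..<2 * L} \<union> WCell ` {..(L + 1)\<^sup>2}"

lemma in_allowed_cells [simp]:
  "ICell i \<in> allowed_cells \<longleftrightarrow> i < 7" "LCell i \<in> allowed_cells \<longleftrightarrow> i < 2 * L" "WCell i \<in> allowed_cells \<longleftrightarrow> i \<le> (L + 1)\<^sup>2"
  by (auto simp: allowed_cells_def)

sublocale resources M \<iota> wt allowed_cells .

definition base :: "'a memory \<Rightarrow> bool" where
  "base \<sigma> \<longleftrightarrow> imem \<sigma> 0 = n \<and> imem \<sigma> 1 = m \<and> (\<forall>i<L. lmem \<sigma> i = (w1 @ w2) ! i) \<and>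
     (\<forall>i\<le>L. wmem \<sigma> (cell L 0 i) = 0)"

definition has_word :: "'a list \<Rightarrow> nat \<Rightarrow> 'a memory \<Rightarrow> bool" where
  "has_word u a \<sigma> \<longleftrightarrow> (\<forall>b<a. lmem \<sigma> (L + b) = u ! b)"

text \<open>A snapshot of the filling order: rows up to \<open>k\<close> are complete, and so are
  the first \<open>i\<close> cells of row \<open>k + 1\<close>. Cells of intervals that would leave
  the word are unconstrained, as they are never read.\<close>

definition has_table :: "'a list \<Rightarrow> nat \<Rightarrow> nat \<Rightarrow> 'a memory \<Rightarrow> bool" where
  "has_table u k i \<sigma> \<longleftrightarrow> (\<forall>k' i'. i' + k' \<le> L \<longrightarrow> k' \<le> k \<or> k' = Suc k \<and> i' < i \<longrightarrow>
     wmem \<sigma> (cell L k' i') = opt \<iota> wt u i' k')"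

text \<open>The pairs that precede \<open>(p, q)\<close> lexicographically, in the order of the two
  outer loops. None precedes \<open>(0, 0)\<close>, where \<open>Min\<close> would be applied to the
  empty set.\<close>

definition has_best :: "nat \<Rightarrow> nat \<Rightarrow> 'a memory \<Rightarrow> bool" where
  "has_best p q \<sigma> \<longleftrightarrow> (p, q) \<noteq> (0, 0) \<longrightarrow>
     wmem \<sigma> 0 = Min ((\<lambda>(p, q). opt \<iota> wt (word p q) 0 L) ` ({..<p} \<times> {..<m} \<union> {p} \<times> {..<q}))"

lemma imem_update [simp]:
  "2 \<le> v \<Longrightarrow> base (\<sigma>\<lparr>imem := (imem \<sigma>)(v := x)\<rparr>) = base \<sigma>"
  "has_word u a (\<sigma>\<lparr>imem := f\<rparr>) = has_word u a \<sigma>"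
  "has_table u k i (\<sigma>\<lparr>imem := f\<rparr>) = has_table u k i \<sigma>"
  "has_best p q (\<sigma>\<lparr>imem := f\<rparr>) = has_best p q \<sigma>"
  by (auto simp: base_def has_word_def has_table_def has_best_def)

lemma has_tableD:
  "has_table u k i \<sigma> \<Longrightarrow> i' + k' \<le> L \<Longrightarrow> k' \<le> k \<or> k' = Suc k \<and> i' < i \<Longrightarrow>
    wmem \<sigma> (cell L k' i') = opt \<iota> wt u i' k'"
  unfolding has_table_def by blast

lemma baseD:
  "base \<sigma> \<Longrightarrow> imem \<sigma> 0 = n" "base \<sigma> \<Longrightarrow> imem \<sigma> (Suc 0) = m"
  by (simp_all add: base_def)

lemma halts_copy_letter:
  assumes "base \<sigma>" "imem \<sigma> 2 = p" "imem \<sigma> 3 = q" "imem \<sigma> 4 = a" "has_word (word p q) a \<sigma>"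
    "has_best p q \<sigma>" "p < n" "q < m" "a < L"
  shows "halts copy_letter \<sigma> 100 (\<lambda>\<sigma>'. imem \<sigma> = imem \<sigma>' \<and> base \<sigma>' \<and> has_best p q \<sigma>' \<and>
    has_word (word p q) (Suc a) \<sigma>')"
proof -
  let ?Q = "\<lambda>\<sigma>'. imem \<sigma> = imem \<sigma>' \<and> base \<sigma>' \<and> has_best p q \<sigma>' \<and> has_word (word p q) (Suc a) \<sigma>'"
  note r = baseD[OF assms(1)] assms(2,3,4)
  have lm: "lmem \<sigma> i = (w1 @ w2) ! i" if "i < L" for i using assms(1) that by (simp add: base_def)
  \<comment> \<open>All four branches store to the same address and differ only in the source, so
    they share this step. The address lies behind the input, which therefore survives.\<close>
  have store: "?Q (\<sigma>\<lparr>lmem := (lmem \<sigma>)(L + a := x)\<rparr>)" if "x = word p q ! a" for x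
    using assms(1,5,6) that by (auto simp: base_def has_best_def has_word_def less_Suc_eq)
  show ?thesis
    unfolding copy_letter_def
  proof (rule halts_Cond[where T = 80])
    assume "fst (beval \<iota> wt \<sigma> (ILess (IAdd (reg 2) (reg 4)) (reg 0)))"
    then have "a + p < n" by (simp add: r)
    then show "halts (LSet (word_exp (reg 4)) (LGet (IAdd (reg 2) (reg 4)))) \<sigma> 80 ?Q"
      by (intro halts_LSet)
        (use store mixed_word_nth(1)[OF assms(7,8)] lm assms(9) in \<open>simp_all add: r\<close>)
  next
    assume "\<not> fst (beval \<iota> wt \<sigma> (ILess (IAdd (reg 2) (reg 4)) (reg 0)))"
    then have 1: "n \<le> a + p" by (simp add: r)
    show "halts (Cond (ILess (reg 4) (reg 0))
       (LSet (word_exp (reg 4)) (LGet (ISub (IAdd (reg 2) (reg 4)) (reg 0))))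
     (Cond (ILess (reg 4) (IAdd (reg 0) (reg 3)))
       (LSet (word_exp (reg 4))
         (LInv (LGet (ISub (IAdd (reg 0) (IAdd (reg 0) (reg 3))) (IAdd (reg 4) (IConst 1))))))
       (LSet (word_exp (reg 4))
         (LInv (LGet (ISub (IAdd (reg 0) (IAdd len_exp (reg 3))) (IAdd (reg 4) (IConst 1)))))))) \<sigma> 80 ?Q"
    proof (rule halts_Cond[where T = 60])
      assume "fst (beval \<iota> wt \<sigma> (ILess (reg 4) (reg 0)))"
      then have "a < n" by (simp add: r)
      then show "halts (LSet (word_exp (reg 4)) (LGet (ISub (IAdd (reg 2) (reg 4)) (reg 0)))) \<sigma> 60 ?Q"
        by (intro halts_LSet)
          (use 1 store mixed_word_nth(2)[OF assms(7,8)] lm assms(7,9) in \<open>simp_all add: r\<close>)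
    next
      assume "\<not> fst (beval \<iota> wt \<sigma> (ILess (reg 4) (reg 0)))"
      then have 2: "n \<le> a" by (simp add: r)
      show "halts (Cond (ILess (reg 4) (IAdd (reg 0) (reg 3)))
       (LSet (word_exp (reg 4))
         (LInv (LGet (ISub (IAdd (reg 0) (IAdd (reg 0) (reg 3))) (IAdd (reg 4) (IConst 1))))))
       (LSet (word_exp (reg 4))
         (LInv (LGet (ISub (IAdd (reg 0) (IAdd len_exp (reg 3))) (IAdd (reg 4) (IConst 1))))))) \<sigma> 60 ?Q"
      proof (rule halts_Cond[where T = 40])
        assume "fst (beval \<iota> wt \<sigma> (ILess (reg 4) (IAdd (reg 0) (reg 3))))"
        then have "a < n + q" by (simp add: r)
        then show "halts (LSet (word_exp (reg 4))
         (LInv (LGet (ISub (IAdd (reg 0) (IAdd (reg 0) (reg 3))) (IAdd (reg 4) (IConst 1)))))) \<sigma> 40 ?Q"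
          by (intro halts_LSet)
            (use 2 store mixed_word_nth(3)[OF assms(7,8)] lm assms(8,9) in \<open>simp_all add: r\<close>)
      next
        assume "\<not> fst (beval \<iota> wt \<sigma> (ILess (reg 4) (IAdd (reg 0) (reg 3))))"
        then have "n + q \<le> a" by (simp add: r)
        then show "halts (LSet (word_exp (reg 4))
         (LInv (LGet (ISub (IAdd (reg 0) (IAdd len_exp (reg 3))) (IAdd (reg 4) (IConst 1)))))) \<sigma> 40 ?Q"
          by (intro halts_LSet)
            (use 2 store mixed_word_nth(4)[OF assms(7,8)] lm assms(8,9) in \<open>simp_all add: r\<close>)
      qed simp_all
    qed simp_all
  qed simp_all
qed

text \<open>The right-hand side of \<open>opt_Suc\<close>, restricted to the partners tried so far:
  \<open>j = 0\<close> leaves the unpaired case, \<open>j = k\<close> gives the full set. Its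
  minimum is the invariant of the innermost loop.\<close>

definition candidates :: "'a list \<Rightarrow> nat \<Rightarrow> nat \<Rightarrow> nat \<Rightarrow> real set" where
  "candidates u i k j = insert (wt (u ! i) + opt \<iota> wt u (Suc i) k)
    ((\<lambda>j. opt \<iota> wt u (Suc i) j + opt \<iota> wt u (i + 2 + j) (k - 1 - j)) `
      {j'. j' < j \<and> u ! i = \<iota> (u ! (i + 1 + j'))})"

lemma candidates_Suc:
  "candidates u i k (Suc j) = (if u ! i = \<iota> (u ! (i + 1 + j))
     then insert (opt \<iota> wt u (Suc i) j + opt \<iota> wt u (i + 2 + j) (k - 1 - j)) (candidates u i k j)
     else candidates u i k j)"
  by (auto simp: candidates_def less_Suc_eq)

lemma candidates_finite: "finite (candidates u i k j)" "candidates u i k j \<noteq> {}"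
  by (simp_all add: candidates_def)

definition frame :: "nat \<Rightarrow> nat \<Rightarrow> 'a memory \<Rightarrow> bool" where
  "frame p q \<sigma> \<longleftrightarrow> base \<sigma> \<and> imem \<sigma> 2 = p \<and> imem \<sigma> 3 = q \<and> has_best p q \<sigma> \<and> has_word (word p q) L \<sigma>"

lemma frame_update [simp]:
  "4 \<le> v \<Longrightarrow> frame p q (\<sigma>\<lparr>imem := (imem \<sigma>)(v := x)\<rparr>) = frame p q \<sigma>"
  by (auto simp: frame_def)

text \<open>A store to row \<open>Suc k\<close> misses row 0 and weight cell 0. The bound on
  \<open>i\<close> keeps the column inside its row, without which addresses of different rows could
  coincide.\<close>

lemma frame_store:
  assumes "frame p q \<sigma>" "i \<le> L"
  shows "frame p q (\<sigma>\<lparr>wmem := (wmem \<sigma>)(cell L (Suc k) i := x)\<rparr>)"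
  using assms by (simp add: frame_def base_def has_word_def has_best_def)

text \<open>In row \<open>k + 1\<close> the invariant speaks only of columns before
  \<open>i\<close>, so the open cell may hold intermediate minima.\<close>

lemma has_table_store:
  assumes "has_table u k i \<sigma>" "i \<le> L"
  shows "has_table u k i (\<sigma>\<lparr>wmem := (wmem \<sigma>)(cell L (Suc k) i := x)\<rparr>)"
  using assms by (auto simp: has_table_def)

lemma frameD:
  assumes "frame p q \<sigma>"
  shows "imem \<sigma> 0 = n" "imem \<sigma> (Suc 0) = m" "imem \<sigma> 2 = p" "imem \<sigma> 3 = q"
    "b < L \<Longrightarrow> lmem \<sigma> (L + b) = word p q ! b"
  using assms by (simp_all add: frame_def base_def has_word_def)

lemma halts_start_cell:
  assumes "frame p q \<sigma>" "imem \<sigma> 4 = k" "imem \<sigma> 5 = i" "i + k < L" "has_table (word p q) k i \<sigma>"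
  shows "halts start_cell \<sigma> 100 (\<lambda>\<sigma>'. imem \<sigma> = imem \<sigma>' \<and> frame p q \<sigma>' \<and> has_table (word p q) k i \<sigma>' \<and>
    wmem \<sigma>' (cell L (Suc k) i) = Min (candidates (word p q) i k 0))"
proof -
  note r = frameD[OF assms(1)] assms(2,3)
  have "wmem \<sigma> (cell L k (Suc i)) = opt \<iota> wt (word p q) (Suc i) k"
    using has_tableD[OF assms(5)] assms(4) by simp
  moreover have "cell L (Suc k) i \<le> (L + 1)\<^sup>2" "cell L k (Suc i) \<le> (L + 1)\<^sup>2"
    using assms(4) by (intro cell_le; simp)+
  ultimately show ?thesis
    unfolding start_cell_def
    by (intro halts_WSet)
      (use assms(1,4,5) frame_store has_table_store in \<open>simp_all add: r candidates_def\<close>)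
qed

lemma halts_improve:
  assumes "frame p q \<sigma>" "imem \<sigma> 4 = k" "imem \<sigma> 5 = i" "imem \<sigma> 6 = j" "i + k < L" "j < k"
    "has_table (word p q) k i \<sigma>" "wmem \<sigma> (cell L (Suc k) i) = Min (candidates (word p q) i k j)"
  shows "halts improve \<sigma> 300 (\<lambda>\<sigma>'. imem \<sigma> = imem \<sigma>' \<and> frame p q \<sigma>' \<and> has_table (word p q) k i \<sigma>' \<and>
    wmem \<sigma>' (cell L (Suc k) i) = Min (candidates (word p q) i k (Suc j)))"
proof -
  let ?u = "word p q"
  note r = frameD[OF assms(1)] assms(2,3,4)
  let ?v = "opt \<iota> wt ?u (Suc i) j + opt \<iota> wt ?u (i + 2 + j) (k - 1 - j)"
  have "cell L (Suc k) i \<le> (L + 1)\<^sup>2" "cell L j (Suc i) \<le> (L + 1)\<^sup>2"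
      "cell L (k - Suc j) (Suc (Suc (i + j))) \<le> (L + 1)\<^sup>2"
    using assms(5,6) by (intro cell_le; simp)+
  note b = this
  have t: "wmem \<sigma> (cell L j (Suc i)) = opt \<iota> wt ?u (Suc i) j"
     "wmem \<sigma> (cell L (k - Suc j) (Suc (Suc (i + j)))) = opt \<iota> wt ?u (Suc (Suc (i + j))) (k - Suc j)"
    using has_tableD[OF assms(7)] assms(5,6) by simp_all
  have l: "lmem \<sigma> (L + i) = ?u ! i" "lmem \<sigma> (L + Suc (i + j)) = ?u ! Suc (i + j)"
    using frameD(5)[OF assms(1), of i] frameD(5)[OF assms(1), of "Suc (i + j)"] assms(5,6) by simp_all
  have v: "fst (weval \<iota> wt \<sigma> split_exp) = ?v" "fst (snd (weval \<iota> wt \<sigma> split_exp)) \<le> 60"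
     "snd (snd (weval \<iota> wt \<sigma> split_exp)) \<subseteq> allowed_cells"
    using t b by (simp_all add: split_exp_def r)
  have min: "Min (candidates ?u i k (Suc j)) =
      (if ?u ! i = \<iota> (?u ! Suc (i + j)) \<and> ?v < Min (candidates ?u i k j) then ?v
       else Min (candidates ?u i k j))"
    by (auto simp: candidates_Suc candidates_finite min_def simp del: Min_less_iff Min_le_iff Min_gr_iff Min_ge_iff)
  show ?thesis
    unfolding improve_def
    \<comment> \<open>The limits 150 for a branch and 300 in total are generous round figures; they
      affect only the constant factor of the running time.\<close>
    apply (rule halts_Cond[where T = 150])
    subgoal using b v l assms(5,6) by (auto simp: r)
    subgoal
      by (rule halts_WSet)
        (use b v l assms min t in \<open>auto simp: r frame_store has_table_store\<close>)
    subgoal by (rule halts_Skip) (use b v l assms min in \<open>auto simp: r\<close>)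
    subgoal using v by simp
    done
qed

lemma has_table_finish_cell:
  assumes "has_table (word p q) k i \<sigma>" "i + k < L"
    "wmem \<sigma> (cell L (Suc k) i) = Min (candidates (word p q) i k k)"
  shows "has_table (word p q) k (Suc i) \<sigma>"
proof -
  \<comment> \<open>A letter may be \<open>\<iota> y\<close> with \<open>y\<close> in
    \<open>w2\<close>; then the law for \<open>y\<close>, under one more \<open>\<iota>\<close>,
    gives the law for \<open>\<iota> y\<close>.\<close>
  have "\<iota> (\<iota> x) = x" if "x \<in> set (word p q)" for x
    using subsetD[OF set_mixed_word that] involution by auto
  then have "opt \<iota> wt (word p q) i (Suc k) = Min (candidates (word p q) i k k)"
    unfolding candidates_def using assms(2) by (intro opt_Suc) (simp_all add: length_mixed_word)
  then show ?thesis
    using assms(1,3) unfolding has_table_def by (metis less_Suc_eq)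
qed

text \<open>An interval of length \<open>Suc k\<close> inside the word has fewer than
  \<open>L - k\<close> letters before it, so these columns are all that row \<open>k + 1\<close>
  requires.\<close>

lemma has_table_finish_row: "has_table u k (L - k) \<sigma> \<Longrightarrow> has_table u (Suc k) 0 \<sigma>"
  unfolding has_table_def by (metis Suc_le_eq add_Suc_right le_SucE less_diff_conv not_less_zero)

lemma has_table_0: "frame p q \<sigma> \<Longrightarrow> has_table u 0 0 \<sigma>"
  by (auto simp: has_table_def frame_def base_def opt_0)

lemma halts_fill_table:
  assumes "frame p q \<sigma>"
  shows "halts fill_table \<sigma> ((L + 1) * ((L + 1) * (100 + (L + 1) * (300 + 18) + 18) + 18))
    (\<lambda>\<sigma>'. frame p q \<sigma>' \<and> has_table (word p q) L 0 \<sigma>')"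
  unfolding fill_table_def
proof (rule halts_For[where I = "\<lambda>k \<sigma>. frame p q \<sigma> \<and> has_table (word p q) k 0 \<sigma>" and h = L])
  fix k \<sigma> assume k: "k < L" "frame p q \<sigma> \<and> has_table (word p q) k 0 \<sigma>" "imem \<sigma> 4 = k"
  show "halts (For 5 (ISub len_exp (reg 4)) (Seq start_cell (For 6 (reg 4) improve))) \<sigma>
      ((L + 1) * (100 + (L + 1) * (300 + 18) + 18))
      (\<lambda>\<sigma>'. imem \<sigma>' 4 = k \<and> frame p q (\<sigma>'\<lparr>imem := (imem \<sigma>')(4 := Suc k)\<rparr>) \<and>
        has_table (word p q) (Suc k) 0 (\<sigma>'\<lparr>imem := (imem \<sigma>')(4 := Suc k)\<rparr>))"
  \<comment> \<open>The loop bound is evaluated anew at every guard and reads cell 4, so the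
    invariant has to carry \<open>imem \<sigma> 4 = k\<close>.\<close>
  proof (rule halts_For[where h = "L - k" and
        I = "\<lambda>i \<sigma>. frame p q \<sigma> \<and> has_table (word p q) k i \<sigma> \<and> imem \<sigma> 4 = k"])
    fix i \<sigma> assume i: "i < L - k" "frame p q \<sigma> \<and> has_table (word p q) k i \<sigma> \<and> imem \<sigma> 4 = k" "imem \<sigma> 5 = i"
    show "halts (Seq start_cell (For 6 (reg 4) improve)) \<sigma> (100 + (L + 1) * (300 + 18))
      (\<lambda>\<sigma>'. imem \<sigma>' 5 = i \<and> frame p q (\<sigma>'\<lparr>imem := (imem \<sigma>')(5 := Suc i)\<rparr>) \<and>
        has_table (word p q) k (Suc i) (\<sigma>'\<lparr>imem := (imem \<sigma>')(5 := Suc i)\<rparr>) \<and>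
        imem (\<sigma>'\<lparr>imem := (imem \<sigma>')(5 := Suc i)\<rparr>) 4 = k)"
    proof (rule halts_Seq[OF halts_start_cell[where k = k and i = i and p = p and q = q]])
      fix \<sigma>1 assume s: "imem \<sigma> = imem \<sigma>1 \<and> frame p q \<sigma>1 \<and> has_table (word p q) k i \<sigma>1 \<and>
        wmem \<sigma>1 (cell L (Suc k) i) = Min (candidates (word p q) i k 0)"
      show "halts (For 6 (reg 4) improve) \<sigma>1 ((L + 1) * (300 + 18))
        (\<lambda>\<sigma>'. imem \<sigma>' 5 = i \<and> frame p q (\<sigma>'\<lparr>imem := (imem \<sigma>')(5 := Suc i)\<rparr>) \<and>
          has_table (word p q) k (Suc i) (\<sigma>'\<lparr>imem := (imem \<sigma>')(5 := Suc i)\<rparr>) \<and>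
          imem (\<sigma>'\<lparr>imem := (imem \<sigma>')(5 := Suc i)\<rparr>) 4 = k)"
      proof (rule halts_For[where h = k and
          I = "\<lambda>j \<sigma>. frame p q \<sigma> \<and> has_table (word p q) k i \<sigma> \<and> imem \<sigma> 4 = k \<and> imem \<sigma> 5 = i \<and>
            wmem \<sigma> (cell L (Suc k) i) = Min (candidates (word p q) i k j)"])
        fix j \<sigma> assume "j < k" "imem \<sigma> 6 = j" "frame p q \<sigma> \<and> has_table (word p q) k i \<sigma> \<and>
          imem \<sigma> 4 = k \<and> imem \<sigma> 5 = i \<and> wmem \<sigma> (cell L (Suc k) i) = Min (candidates (word p q) i k j)"
        then show "halts improve \<sigma> 300 (\<lambda>\<sigma>'. imem \<sigma>' 6 = j \<and>
            frame p q (\<sigma>'\<lparr>imem := (imem \<sigma>')(6 := Suc j)\<rparr>) \<and>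
            has_table (word p q) k i (\<sigma>'\<lparr>imem := (imem \<sigma>')(6 := Suc j)\<rparr>) \<and>
            imem (\<sigma>'\<lparr>imem := (imem \<sigma>')(6 := Suc j)\<rparr>) 4 = k \<and>
            imem (\<sigma>'\<lparr>imem := (imem \<sigma>')(6 := Suc j)\<rparr>) 5 = i \<and>
            wmem (\<sigma>'\<lparr>imem := (imem \<sigma>')(6 := Suc j)\<rparr>) (cell L (Suc k) i) =
              Min (candidates (word p q) i k (Suc j)))"
          using i(1) by (intro halts_mono[OF halts_improve[where k = k and i = i and j = j]]) auto
      next
        fix \<sigma> assume "frame p q \<sigma> \<and> has_table (word p q) k i \<sigma> \<and> imem \<sigma> 4 = k \<and> imem \<sigma> 5 = i \<and>
            wmem \<sigma> (cell L (Suc k) i) = Min (candidates (word p q) i k k)"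
        then show "imem \<sigma> 5 = i \<and> frame p q (\<sigma>\<lparr>imem := (imem \<sigma>)(5 := Suc i)\<rparr>) \<and>
          has_table (word p q) k (Suc i) (\<sigma>\<lparr>imem := (imem \<sigma>)(5 := Suc i)\<rparr>) \<and>
          imem (\<sigma>\<lparr>imem := (imem \<sigma>)(5 := Suc i)\<rparr>) 4 = k"
          using has_table_finish_cell[of p q k i \<sigma>] i(1) by simp
      qed (use k i s capacity in simp_all)
    qed (use i in auto)
  next
    fix \<sigma> assume "frame p q \<sigma> \<and> has_table (word p q) k (L - k) \<sigma> \<and> imem \<sigma> 4 = k"
    then show "imem \<sigma> 4 = k \<and> frame p q (\<sigma>\<lparr>imem := (imem \<sigma>)(4 := Suc k)\<rparr>) \<and>
        has_table (word p q) (Suc k) 0 (\<sigma>\<lparr>imem := (imem \<sigma>)(4 := Suc k)\<rparr>)"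
      using has_table_finish_row[of "word p q" k \<sigma>] by simp
  qed (use k capacity in \<open>auto simp: frameD\<close>)
qed (use assms capacity has_table_0 in \<open>auto simp: frameD\<close>)

lemma halts_record_min:
  assumes "frame p q \<sigma>" "has_table (word p q) L 0 \<sigma>"
  shows "halts record_min \<sigma> 150 (\<lambda>\<sigma>'. imem \<sigma> = imem \<sigma>' \<and> base \<sigma>' \<and> has_best p (Suc q) \<sigma>')"
proof -
  let ?D = "{..<p} \<times> {..<m} \<union> {p} \<times> {..<q}"
  let ?g = "\<lambda>(p, q). opt \<iota> wt (word p q) 0 L"
  note r = frameD[OF assms(1)]
  have t: "wmem \<sigma> (cell L L 0) = ?g (p, q)" using has_tableD[OF assms(2), of 0 L] by simp
  have b: "cell L L 0 \<le> (L + 1)\<^sup>2" by (rule cell_le) simp_all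
  have D: "{..<p} \<times> {..<m} \<union> {p} \<times> {..<Suc q} = insert (p, q) ?D" by auto
  \<comment> \<open>The final state is left arbitrary, so that one equivalence serves the branch
    that stores and the branch that skips.\<close>
  have best: "has_best p (Suc q) \<sigma>' \<longleftrightarrow> wmem \<sigma>' 0 =
      (if p + q < 1 \<or> ?g (p, q) < wmem \<sigma> 0 then ?g (p, q) else wmem \<sigma> 0)" for \<sigma>' :: "'a memory"
  proof (cases "p + q < 1")
    case True
    then show ?thesis by (simp add: has_best_def lessThan_Suc)
  next
    case False
    \<comment> \<open>If \<open>q = 0\<close>, then \<open>p > 0\<close>, and an earlier pair exists
      because \<open>w2\<close> is nonempty.\<close>
    then have "?D \<noteq> {}" using nonempty(2) by auto
    moreover have "wmem \<sigma> 0 = Min (?g ` ?D)" using assms(1) False by (auto simp: frame_def has_best_def)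
    ultimately have "Min (?g ` insert (p, q) ?D) = min (?g (p, q)) (wmem \<sigma> 0)"
      by (simp add: Min_insert del: insert_is_Un)
    then show ?thesis using False unfolding has_best_def D by (auto simp: min_def)
  qed
  have base: "base (\<sigma>\<lparr>wmem := (wmem \<sigma>)(0 := x)\<rparr>)" "base \<sigma>" for x
    using assms(1) by (simp_all add: frame_def base_def)
  show ?thesis
    unfolding record_min_def
    apply (rule halts_Cond[where T = 100])
    subgoal using b by (simp add: r)
    subgoal by (rule halts_Skip) (use b t best base in \<open>auto simp: r\<close>)
    subgoal by (rule halts_WSet) (use b t best base in \<open>auto simp: r\<close>)
    subgoal by simp
    done
qed

lemma halts_distance_program:
  assumes "base \<sigma>"
  shows "halts distance_program \<sigma> (758 * (L + 1) ^ 5)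
    (\<lambda>\<sigma>'. wmem \<sigma>' 0 = cancellation_distance \<iota> wt w1 w2)"
proof -
  define s where "s = L + 1"
  \<comment> \<open>The cost of one pair \<open>(p, q)\<close>: copying the word, filling the table,
    updating the minimum. Every loop runs at most \<open>L\<close> rounds, so
    \<open>s = L + 1\<close> is a strict bound for all of them.\<close>
  let ?B = "s * (100 + 18) + (s * (s * (100 + s * (300 + 18) + 18) + 18) + 150)"
  have "halts distance_program \<sigma> (s * (s * (?B + 18) + 18))
    (\<lambda>\<sigma>'. wmem \<sigma>' 0 = cancellation_distance \<iota> wt w1 w2)"
    unfolding distance_program_def
  proof (rule halts_For[where I = "\<lambda>p \<sigma>. base \<sigma> \<and> has_best p 0 \<sigma>" and h = n])
    fix p \<sigma> assume p: "p < n" "base \<sigma> \<and> has_best p 0 \<sigma>" "imem \<sigma> 2 = p"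
    show "halts (For 3 (reg 1) (Seq (For 4 len_exp copy_letter) (Seq fill_table record_min))) \<sigma>
      (s * (?B + 18)) (\<lambda>\<sigma>'. imem \<sigma>' 2 = p \<and> base (\<sigma>'\<lparr>imem := (imem \<sigma>')(2 := Suc p)\<rparr>) \<and>
        has_best (Suc p) 0 (\<sigma>'\<lparr>imem := (imem \<sigma>')(2 := Suc p)\<rparr>))"
    proof (rule halts_For[where I = "\<lambda>q \<sigma>. base \<sigma> \<and> imem \<sigma> 2 = p \<and> has_best p q \<sigma>" and h = m])
      fix q \<sigma> assume q: "q < m" "base \<sigma> \<and> imem \<sigma> 2 = p \<and> has_best p q \<sigma>" "imem \<sigma> 3 = q"
      show "halts (Seq (For 4 len_exp copy_letter) (Seq fill_table record_min)) \<sigma> ?B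
        (\<lambda>\<sigma>'. imem \<sigma>' 3 = q \<and> base (\<sigma>'\<lparr>imem := (imem \<sigma>')(3 := Suc q)\<rparr>) \<and>
          imem (\<sigma>'\<lparr>imem := (imem \<sigma>')(3 := Suc q)\<rparr>) 2 = p \<and>
          has_best p (Suc q) (\<sigma>'\<lparr>imem := (imem \<sigma>')(3 := Suc q)\<rparr>))"
      proof (rule halts_Seq[where R = "frame p q"])
        show "halts (For 4 len_exp copy_letter) \<sigma> (s * (100 + 18)) (frame p q)"
        proof (rule halts_For[where h = L and I = "\<lambda>a \<sigma>. base \<sigma> \<and> imem \<sigma> 2 = p \<and> imem \<sigma> 3 = q \<and>
            has_best p q \<sigma> \<and> has_word (word p q) a \<sigma>"])
          fix a \<sigma> assume "a < L" "imem \<sigma> 4 = a" "base \<sigma> \<and> imem \<sigma> 2 = p \<and> imem \<sigma> 3 = q \<and>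
            has_best p q \<sigma> \<and> has_word (word p q) a \<sigma>"
          then show "halts copy_letter \<sigma> 100 (\<lambda>\<sigma>'. imem \<sigma>' 4 = a \<and>
              base (\<sigma>'\<lparr>imem := (imem \<sigma>')(4 := Suc a)\<rparr>) \<and>
              imem (\<sigma>'\<lparr>imem := (imem \<sigma>')(4 := Suc a)\<rparr>) 2 = p \<and>
              imem (\<sigma>'\<lparr>imem := (imem \<sigma>')(4 := Suc a)\<rparr>) 3 = q \<and>
              has_best p q (\<sigma>'\<lparr>imem := (imem \<sigma>')(4 := Suc a)\<rparr>) \<and>
              has_word (word p q) (Suc a) (\<sigma>'\<lparr>imem := (imem \<sigma>')(4 := Suc a)\<rparr>))"
            using p(1) q(1)
            by (intro halts_mono[OF halts_copy_letter[where p = p and q = q and a = a]]) auto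
        qed (use q capacity in \<open>auto simp: frame_def baseD has_word_def s_def\<close>)
      next
        fix \<sigma> assume "frame p q \<sigma>"
        show "halts (Seq fill_table record_min) \<sigma>
            (s * (s * (100 + s * (300 + 18) + 18) + 18) + 150)
          (\<lambda>\<sigma>'. imem \<sigma>' 3 = q \<and> base (\<sigma>'\<lparr>imem := (imem \<sigma>')(3 := Suc q)\<rparr>) \<and>
            imem (\<sigma>'\<lparr>imem := (imem \<sigma>')(3 := Suc q)\<rparr>) 2 = p \<and>
            has_best p (Suc q) (\<sigma>'\<lparr>imem := (imem \<sigma>')(3 := Suc q)\<rparr>))"
          unfolding s_def
          by (rule halts_Seq[OF halts_fill_table[OF \<open>frame p q \<sigma>\<close>]],
              rule halts_mono[OF halts_record_min]) (auto simp: frame_def)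
      qed
    next
      fix \<sigma> assume I: "base \<sigma> \<and> imem \<sigma> 2 = p \<and> has_best p m \<sigma>"
      \<comment> \<open>The end of one row of pairs and the start of the next describe the same set;
        \<open>m > 0\<close> keeps \<open>(p, m)\<close> away from the exempted
        \<open>(0, 0)\<close>.\<close>
      have "{..<Suc p} \<times> {..<m} \<union> {Suc p} \<times> {..<0} = {..<p} \<times> {..<m} \<union> {p} \<times> {..<m}" by auto
      then have "has_best (Suc p) 0 \<sigma>" using I nonempty(2) unfolding has_best_def by simp
      then show "imem \<sigma> 2 = p \<and> base (\<sigma>\<lparr>imem := (imem \<sigma>)(2 := Suc p)\<rparr>) \<and>
        has_best (Suc p) 0 (\<sigma>\<lparr>imem := (imem \<sigma>)(2 := Suc p)\<rparr>)" using I by simp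
    qed (use p capacity nonempty in \<open>auto simp: baseD s_def\<close>)
  next
    fix \<sigma> assume "base \<sigma> \<and> has_best n 0 \<sigma>"
    then show "wmem \<sigma> 0 = cancellation_distance \<iota> wt w1 w2"
      using nonempty by (simp add: has_best_def cancellation_distance_eq_Min_opt)
  qed (use assms capacity nonempty in \<open>auto simp: baseD has_best_def s_def\<close>)
  \<comment> \<open>758 is the sum of the coefficients 318, 118, 136, 168 and 18 of the expanded
    bound, all powers being at most \<open>s ^ 5\<close>.\<close>
  moreover have "s * (s * (?B + 18) + 18) \<le> 758 * s ^ 5"
  proof -
    have "s ^ e \<le> s ^ 5" if "e \<le> 5" for e
      using that by (intro power_increasing) (simp_all add: s_def)
    from this[of 1] this[of 2] this[of 3] this[of 4]
    have "s \<le> s ^ 5" "s ^ 2 \<le> s ^ 5" "s ^ 3 \<le> s ^ 5" "s ^ 4 \<le> s ^ 5" by simp_all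
    moreover have "s * (s * (?B + 18) + 18) = 318 * s ^ 5 + 118 * s ^ 4 + 136 * s ^ 3 + 168 * s ^ 2 + 18 * s"
      by (simp add: algebra_simps power_numeral_reduce)
    ultimately show ?thesis by linarith
  qed
  ultimately show ?thesis unfolding s_def by (rule halts_mono) assumption
qed

section \<open>Total resources and the asymptotic bounds\<close>

lemma card_allowed_cells: "card allowed_cells \<le> 10 * (L + 1)\<^sup>2"
proof -
  have "card allowed_cells \<le> card (ICell ` {..<7}) + card (LCell ` {..<2 * L}) + card (WCell ` {..(L + 1)\<^sup>2})"
    unfolding allowed_cells_def by (meson add_le_mono1 card_Un_le order_trans)
  also have "\<dots> = 7 + 2 * L + ((L + 1)\<^sup>2 + 1)" by (simp add: card_image inj_on_def)
  also have "\<dots> \<le> 10 * (L + 1)\<^sup>2" by (simp add: power2_eq_square algebra_simps)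
  finally show ?thesis .
qed

lemma finite_allowed_cells: "finite allowed_cells"
  by (simp add: allowed_cells_def)

lemma computes_within_distance:
  "computes_within M \<iota> wt distance_program w1 w2 (cancellation_distance \<iota> wt w1 w2)
     (758 * (L + 1) ^ 5) (10 * (L + 1)\<^sup>2)"
  unfolding computes_within_def
proof (intro allI impI)
  fix \<sigma> assume "input_memory w1 w2 \<sigma>"
  then have "base \<sigma>" by (auto simp: input_memory_def base_def)
  then obtain t Y \<sigma>' where "exec M \<iota> wt distance_program \<sigma> t Y \<sigma>'" "t \<le> 758 * (L + 1) ^ 5"
    "Y \<subseteq> allowed_cells" "wmem \<sigma>' 0 = cancellation_distance \<iota> wt w1 w2"
    using halts_distance_program unfolding halts_def by blast
  moreover from this(3) have "card Y \<le> 10 * (L + 1)\<^sup>2"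
    using card_mono[OF finite_allowed_cells] card_allowed_cells le_trans by blast
  ultimately show "\<exists>t X \<sigma>'. exec M \<iota> wt distance_program \<sigma> t X \<sigma>' \<and>
      wmem \<sigma>' 0 = cancellation_distance \<iota> wt w1 w2 \<and> t \<le> 758 * (L + 1) ^ 5 \<and>
      card X \<le> 10 * (L + 1)\<^sup>2"
    by blast
qed

end

theorem theorem3p4:
  "\<exists>(P :: com) (T :: nat \<Rightarrow> nat) (Sp :: nat \<Rightarrow> nat) (M :: nat \<Rightarrow> nat) (k :: nat).
     (\<lambda>N. real (T N)) \<in> O(\<lambda>N. real N ^ 5) \<and>
     (\<lambda>N. real (Sp N)) \<in> O(\<lambda>N. real N ^ 2) \<and>
     (\<lambda>N. real (M N)) \<in> O(\<lambda>N. real N ^ k) \<and>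
     (\<forall>(S :: 'a set) (\<iota> :: 'a \<Rightarrow> 'a) (wt :: 'a \<Rightarrow> real) (w1 :: 'a list) (w2 :: 'a list).
        symmetric_set S \<iota> \<and> weight_function S \<iota> wt \<and>
        set w1 \<subseteq> S \<and> set w2 \<subseteq> S \<and> length w1 \<ge> 1 \<and> length w2 \<ge> 1 \<longrightarrow>
        (let N = max (length w1) (length w2) in
          computes_within (M N) \<iota> wt P w1 w2 (cancellation_distance \<iota> wt w1 w2) (T N) (Sp N)))"
proof (intro exI conjI allI impI)
  \<comment> \<open>The combined length is at most \<open>2 * N\<close>, which bounds every counter;
    as \<open>N \<ge> 1\<close>, adding 1 still stays within \<open>3 * N\<close>.\<close>
  show "(\<lambda>N. real (758 * (3 * N) ^ 5)) \<in> O(\<lambda>N. real N ^ 5)"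
    "(\<lambda>N. real (10 * (3 * N) ^ 2)) \<in> O(\<lambda>N. real N ^ 2)"
    "(\<lambda>N. real (2 * N)) \<in> O(\<lambda>N. real N ^ 1)"
    by (simp_all add: power_mult_distrib)
  fix S \<iota> wt and w1 w2 :: "'a list"
  assume *: "symmetric_set S \<iota> \<and> weight_function S \<iota> wt \<and>
    set w1 \<subseteq> S \<and> set w2 \<subseteq> S \<and> length w1 \<ge> 1 \<and> length w2 \<ge> 1"
  define N where "N = max (length w1) (length w2)"
  interpret distance_run "2 * N" \<iota> wt w1 w2
    by unfold_locales (use * in \<open>auto simp: symmetric_set_def N_def\<close>)
  have "length w1 + length w2 + 1 \<le> 3 * N" using * by (auto simp: N_def)
  then have "758 * (length w1 + length w2 + 1) ^ 5 \<le> 758 * (3 * N) ^ 5"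
    "10 * (length w1 + length w2 + 1)\<^sup>2 \<le> 10 * (3 * N) ^ 2"
    by (intro mult_le_mono2 power_mono; simp)+
  then have "computes_within (2 * N) \<iota> wt distance_program w1 w2 (cancellation_distance \<iota> wt w1 w2)
      (758 * (3 * N) ^ 5) (10 * (3 * N) ^ 2)"
    using computes_within_distance unfolding computes_within_def by (meson order_trans)
  then show "let N = max (length w1) (length w2) in
    computes_within (2 * N) \<iota> wt distance_program w1 w2 (cancellation_distance \<iota> wt w1 w2)
      (758 * (3 * N) ^ 5) (10 * (3 * N) ^ 2)"
    by (simp add: N_def Let_def)
qed

end
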